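(* Let $\mathcal{R}$ be a von Neumann algebra and let $\mathcal{O}(\mathcal{R}):=\{f_A : A\in\mathcal{R}_{sa}\}$ be the set of observable functions on $\mathcal{Q}(\mathcal{R})$. Then $\mathcal{O}(\mathcal{R})=C_b(\mathcal{Q}(\mathcal{R}),\mathbb{R})$, the set of all bounded continuous real functions on $\mathcal{Q}(\mathcal{R})$, if and only if $\mathcal{R}$ is abelian.
   Context: $\mathcal{R}_{sa}$ is the set of self-adjoint elements of $\mathcal{R}$; $\mathcal{P}(\mathcal{R})$ the lattice of projections of $\mathcal{R}$. A quasipoint of $\mathcal{P}(\mathcal{R})$ is a maximal subset $\mathfrak{B}\subseteq\mathcal{P}(\mathcal{R})$ such that $0\notin\mathfrak{B}$ and for all $P,Q\in\mathfrak{B}$ there is $R\in\mathfrak{B}$ with $R\le P\wedge Q$. $\mathcal{Q}(\mathcal{R})$ is the set of quasipoints, with the topology generated by the basis $\mathcal{Q}_P(\mathcal{R})=\{\mathfrak{B}: P\in\mathfrak{B}\}$. For $A\in\mathcal{R}_{sa}$ with (right-continuous) spectral family $(E^A_\lambda)$, $f_A(\mathfrak{B}):=\inf\{\lambda : E^A_\lambda\in\mathfrak{B}\}$. *)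

theory Defs
  imports "HOL-Analysis.Analysis"
begin

class scaleC =
  fixes scaleC :: "complex \<Rightarrow> 'a \<Rightarrow> 'a" (infixr "*\<^sub>C" 75)

class complex_vector = scaleC + real_vector +
  assumes scaleC_add_right: "a *\<^sub>C (x + y) = a *\<^sub>C x + a *\<^sub>C y"
    and scaleC_add_left: "(a + b) *\<^sub>C x = a *\<^sub>C x + b *\<^sub>C x"
    and scaleC_scaleC: "a *\<^sub>C (b *\<^sub>C x) = (a * b) *\<^sub>C x"
    and scaleC_one: "1 *\<^sub>C x = x"
    and scaleR_scaleC: "scaleR r x = of_real r *\<^sub>C x"

class complex_inner = complex_vector + real_normed_vector +
  fixes cinner :: "'a \<Rightarrow> 'a \<Rightarrow> complex"
  assumes cinner_commute: "cinner x y = cnj (cinner y x)"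
    and cinner_add_left: "cinner (x + y) z = cinner x z + cinner y z"
    and cinner_scaleC_left: "cinner (a *\<^sub>C x) y = cnj a * cinner x y"
    and cinner_self_real_nonneg: "Im (cinner x x) = 0 \<and> Re (cinner x x) \<ge> 0"
    and cinner_eq_zero_iff: "cinner x x = 0 \<longleftrightarrow> x = 0"
    and norm_eq_sqrt_cinner: "norm x = sqrt (Re (cinner x x))"

class chilbert_space = complex_inner + complete_space

definition clinear :: "('a::complex_vector \<Rightarrow> 'b::complex_vector) \<Rightarrow> bool" where
  "clinear T \<longleftrightarrow> (\<forall>x y. T (x + y) = T x + T y) \<and> (\<forall>a x. T (a *\<^sub>C x) = a *\<^sub>C T x)"

definition bops :: "('h::chilbert_space \<Rightarrow> 'h) set" where
  "bops = {T. clinear T \<and> (\<exists>K. \<forall>x. norm (T x) \<le> norm x * K)}"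

definition adj :: "('h::chilbert_space \<Rightarrow> 'h) \<Rightarrow> ('h \<Rightarrow> 'h)" where
  "adj T = (THE S. \<forall>x y. cinner (T x) y = cinner x (S y))"

definition commutant :: "('h::chilbert_space \<Rightarrow> 'h) set \<Rightarrow> ('h \<Rightarrow> 'h) set" where
  "commutant S = {T \<in> bops. \<forall>A\<in>S. T \<circ> A = A \<circ> T}"

definition von_neumann_algebra :: "('h::chilbert_space \<Rightarrow> 'h) set \<Rightarrow> bool" where
  "von_neumann_algebra R \<longleftrightarrow>
     R \<subseteq> bops \<and> id \<in> R \<and>
     (\<forall>A\<in>R. \<forall>B\<in>R. (\<lambda>x. A x + B x) \<in> R \<and> A \<circ> B \<in> R) \<and>
     (\<forall>A\<in>R. \<forall>c. (\<lambda>x. c *\<^sub>C A x) \<in> R) \<and>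
     (\<forall>A\<in>R. adj A \<in> R) \<and>
     commutant (commutant R) = R"

definition abelian :: "('h::chilbert_space \<Rightarrow> 'h) set \<Rightarrow> bool" where
  "abelian R \<longleftrightarrow> (\<forall>A\<in>R. \<forall>B\<in>R. A \<circ> B = B \<circ> A)"

definition self_adjoints :: "('h::chilbert_space \<Rightarrow> 'h) set \<Rightarrow> ('h \<Rightarrow> 'h) set" where
  "self_adjoints R = {A \<in> R. adj A = A}"

definition is_projection :: "('h::chilbert_space \<Rightarrow> 'h) \<Rightarrow> bool" where
  "is_projection P \<longleftrightarrow> P \<in> bops \<and> P \<circ> P = P \<and> adj P = P"

definition projections :: "('h::chilbert_space \<Rightarrow> 'h) set \<Rightarrow> ('h \<Rightarrow> 'h) set" where
  "projections R = {P \<in> R. is_projection P}"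

text \<open>Order of projections: \<open>P \<le> Q\<close> iff \<open>P Q = P\<close> (range inclusion).\<close>
definition proj_le :: "('h::chilbert_space \<Rightarrow> 'h) \<Rightarrow> ('h \<Rightarrow> 'h) \<Rightarrow> bool" where
  "proj_le P Q \<longleftrightarrow> P \<circ> Q = P"

definition proj_meet :: "('h::chilbert_space \<Rightarrow> 'h) set \<Rightarrow> ('h \<Rightarrow> 'h) \<Rightarrow> ('h \<Rightarrow> 'h) \<Rightarrow> ('h \<Rightarrow> 'h)" where
  "proj_meet R P Q = (THE S. S \<in> projections R \<and> proj_le S P \<and> proj_le S Q \<and>
       (\<forall>T\<in>projections R. proj_le T P \<and> proj_le T Q \<longrightarrow> proj_le T S))"

definition filter_base :: "('h::chilbert_space \<Rightarrow> 'h) set \<Rightarrow> ('h \<Rightarrow> 'h) set \<Rightarrow> bool" where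
  "filter_base R B \<longleftrightarrow> B \<subseteq> projections R \<and> (\<lambda>x. 0) \<notin> B \<and>
     (\<forall>P\<in>B. \<forall>Q\<in>B. \<exists>S\<in>B. proj_le S (proj_meet R P Q))"

definition quasipoints :: "('h::chilbert_space \<Rightarrow> 'h) set \<Rightarrow> ('h \<Rightarrow> 'h) set set" where
  "quasipoints R = {B. filter_base R B \<and> (\<forall>C. filter_base R C \<and> B \<subseteq> C \<longrightarrow> C = B)}"

definition qp_basic :: "('h::chilbert_space \<Rightarrow> 'h) set \<Rightarrow> ('h \<Rightarrow> 'h) \<Rightarrow> ('h \<Rightarrow> 'h) set set" where
  "qp_basic R P = {B \<in> quasipoints R. P \<in> B}"

definition qp_topology :: "('h::chilbert_space \<Rightarrow> 'h) set \<Rightarrow> ('h \<Rightarrow> 'h) set topology" where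
  "qp_topology R = topology_generated_by {qp_basic R P | P. P \<in> projections R}"

text \<open>\<open>E\<close> is the (right-continuous) spectral family of \<open>A\<close>: an increasing,
  strongly right-continuous family of projections, vanishing below some \<open>a\<close>,
  equal to the identity from some \<open>b\<close> on, with \<open>A = \<integral>\<^sub>a\<^sup>b \<lambda> dE\<^sub>\<lambda>\<close>
  as a norm limit of Riemann--Stieltjes sums.\<close>
definition spectral_family_of ::
    "('h::chilbert_space \<Rightarrow> 'h) \<Rightarrow> (real \<Rightarrow> 'h \<Rightarrow> 'h) \<Rightarrow> bool" where
  "spectral_family_of A E \<longleftrightarrow>
     (\<forall>l. is_projection (E l)) \<and>
     (\<forall>l m. l \<le> m \<longrightarrow> proj_le (E l) (E m)) \<and>
     (\<forall>l x. ((\<lambda>m. E m x) \<longlongrightarrow> E l x) (at_right l)) \<and>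
     (\<exists>a b. a < b \<and> (\<forall>l\<le>a. E l = (\<lambda>x. 0)) \<and> (\<forall>l\<ge>b. E l = id) \<and>
        (\<forall>\<epsilon>>0. \<exists>\<delta>>0. \<forall>(n::nat) (p::nat \<Rightarrow> real) (t::nat \<Rightarrow> real).
            p 0 = a \<and> p n = b \<and>
            (\<forall>k<n. p k < p (Suc k) \<and> p (Suc k) - p k < \<delta> \<and> p k \<le> t k \<and> t k \<le> p (Suc k))
            \<longrightarrow> onorm (\<lambda>x. A x - (\<Sum>k<n. t k *\<^sub>R (E (p (Suc k)) x - E (p k) x))) \<le> \<epsilon>))"

definition spectral_family :: "('h::chilbert_space \<Rightarrow> 'h) \<Rightarrow> real \<Rightarrow> 'h \<Rightarrow> 'h" where
  "spectral_family A = (THE E. spectral_family_of A E)"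

definition obs_fun :: "('h::chilbert_space \<Rightarrow> 'h) \<Rightarrow> ('h \<Rightarrow> 'h) set \<Rightarrow> real" where
  "obs_fun A B = Inf {l. spectral_family A l \<in> B}"

text \<open>Functions on \<open>\<Q>(R)\<close> are represented as extensional functions on \<open>quasipoints R\<close>.\<close>
definition observable_functions :: "('h::chilbert_space \<Rightarrow> 'h) set \<Rightarrow> (('h \<Rightarrow> 'h) set \<Rightarrow> real) set" where
  "observable_functions R = {restrict (obs_fun A) (quasipoints R) | A. A \<in> self_adjoints R}"

definition bounded_continuous_functions ::
    "('h::chilbert_space \<Rightarrow> 'h) set \<Rightarrow> (('h \<Rightarrow> 'h) set \<Rightarrow> real) set" where
  "bounded_continuous_functions R =
     {f \<in> extensional (quasipoints R). continuous_map (qp_topology R) euclideanreal f \<and>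
        bounded (f ` quasipoints R)}"

end

theory Submission
  imports Defs
begin

text \<open>
  The spectral theorem is proved after Lengyel and Stone: for \<open>B = A + c \<ge> 0\<close>, the range of the spectral
  projection at \<open>\<lambda>\<close> consists of the vectors with \<open>\<parallel>B\<^sup>n x\<parallel> \<le> (\<lambda> + c)\<^sup>n \<parallel>x\<parallel>\<close> for all \<open>n\<close>. This set is visibly
  determined by \<open>A\<close> and invariant under the commutant of \<open>A\<close>, so spectral projections are unique and lie
  in \<open>\<R>\<close>.

  Every \<open>\<Q>\<^sub>P\<close> is clopen, so every \<open>f\<^sub>A\<close> is continuous, and the indicator of \<open>\<Q>\<^sub>P\<close> is a bounded continuous
  function. If that indicator equals \<open>f\<^sub>A\<close>, then the complement of \<open>\<Q>\<^sub>P\<close> is \<open>\<Q>\<^sub>E\<close> with \<open>E = E\<^sup>A\<^bsub>1/2\<^esub>\<close>, so \<open>P\<close> has a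
  largest disjoint projection and therefore commutes with every projection. Conversely, for abelian \<open>\<R>\<close>
  and a continuous \<open>f\<close>, the supremum \<open>E\<^sub>\<lambda>\<close> of all \<open>P\<close> with \<open>f \<le> \<lambda>\<close> on \<open>\<Q>\<^sub>P\<close> is a spectral family, and
  \<open>f = f\<^sub>A\<close> for \<open>A = \<integral> \<lambda> dE\<^sub>\<lambda>\<close>.
\<close>

section \<open>Complex Hilbert spaces\<close>

text \<open>\<open>spectral_family\<close> is a definite description, so \<open>obs_fun\<close>
  carries information only after existence and uniqueness of spectral families are both proved. The
  growth subspaces are easy to define and to show invariant; the hard part is that \<open>B\<close>
  is bounded below by the level on their orthogonal complements. Partial Neumann sums give this
  without functional calculus. On a spectral slice one then has a norm bound from above but only a
  quadratic-form bound from below, so the squared error is linear, not quadratic, in the width of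
  the slice. Orthogonality of the slices makes that enough for norm convergence.

  In the lattice, the obstacle is that disjoint projections (meet zero) need not be orthogonal,
  while quasipoints detect only disjointness. Both directions turn on this gap: commutativity closes
  it, which keeps the supremum of a family from meeting a projection disjoint from every member;
  conversely, a basic complement of every \<open>qp_basic R P\<close> closes it and so forces
  commutativity.\<close>

lemma scaleC_zero_right [simp]: "a *\<^sub>C (0::'a::complex_vector) = 0"
  using scaleC_add_right[of a "0::'a" 0] by simp

lemma scaleC_zero_left [simp]: "0 *\<^sub>C (x::'a::complex_vector) = 0"
  using scaleC_add_left[of 0 0 x] by simp

lemma scaleC_minus_one: "(-1) *\<^sub>C (x::'a::complex_vector) = - x"
  using scaleR_scaleC[of "-1" x] by simp

lemma cinner_add_right: "cinner x (y + z) = cinner x y + cinner x (z::'a::complex_inner)"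
  by (metis cinner_add_left cinner_commute complex_cnj_add)

lemma cinner_scaleC_right: "cinner x (a *\<^sub>C y) = a * cinner x (y::'a::complex_inner)"
  by (metis cinner_commute cinner_scaleC_left complex_cnj_cnj complex_cnj_mult)

lemma cinner_scaleR_left: "cinner (r *\<^sub>R x) y = of_real r * cinner x (y::'a::complex_inner)"
  by (simp add: scaleR_scaleC cinner_scaleC_left)

lemma cinner_scaleR_right: "cinner x (r *\<^sub>R y) = of_real r * cinner x (y::'a::complex_inner)"
  by (simp add: scaleR_scaleC cinner_scaleC_right)

lemma Re_cinner_self: "Re (cinner x x) = (norm (x::'a::complex_inner))\<^sup>2"
  using cinner_self_real_nonneg[of x] by (simp add: norm_eq_sqrt_cinner)

lemma cinner_self: "cinner x x = of_real ((norm (x::'a::complex_inner))\<^sup>2)"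
  using cinner_self_real_nonneg[of x] by (simp add: complex_eq_iff Re_cinner_self)

lemma Re_cinner_commute: "Re (cinner x y) = Re (cinner y (x::'a::complex_inner))"
  by (subst cinner_commute) simp

lemma norm_add_sq: "(norm (x + y))\<^sup>2 = (norm x)\<^sup>2 + 2 * Re (cinner x y) + (norm (y::'a::complex_inner))\<^sup>2"
  using Re_cinner_commute[of x y]
  by (simp add: Re_cinner_self[symmetric] cinner_add_left cinner_add_right)

lemma norm_scaleC: "norm (a *\<^sub>C x) = cmod a * norm (x::'a::complex_inner)"
proof -
  have "(norm (a *\<^sub>C x))\<^sup>2 = Re (cnj a * a * of_real ((norm x)\<^sup>2))"
    using Re_cinner_self[of "a *\<^sub>C x"]
    by (simp only: cinner_scaleC_left cinner_scaleC_right cinner_self[of x] mult_ac)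
  also have "\<dots> = (cmod a * norm x)\<^sup>2"
    by (simp add: cmod_power2 power_mult_distrib) (simp add: power2_eq_square algebra_simps)
  finally show ?thesis
    by (simp add: power2_eq_iff_nonneg)
qed

text \<open>The class already assumes the triangle inequality for the norm, so Cauchy-Schwarz is
  read off from its square.\<close>

lemma Re_cinner_le: "Re (cinner x y) \<le> norm x * norm (y::'a::complex_inner)"
proof -
  have "(norm (x + y))\<^sup>2 \<le> (norm x + norm y)\<^sup>2"
    by (intro power_mono norm_triangle_ineq) simp
  thus ?thesis
    by (simp add: norm_add_sq power2_sum)
qed

lemma cmod_cinner_le: "cmod (cinner x y) \<le> norm x * norm (y::'a::complex_inner)"
proof (cases "cinner x y = 0")
  case False
  \<comment> \<open>The unit scalar \<open>u\<close> rotates \<open>cinner x y\<close> onto the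
    positive real axis, where the bound on real parts applies.\<close>
  define u where "u = cnj (sgn (cinner x y))"
  have u: "cmod u = 1"
    using False by (simp add: u_def norm_sgn)
  have "cinner x (u *\<^sub>C y) = of_real (cmod (cinner x y))"
    unfolding cinner_scaleC_right u_def
    using False complex_norm_square[of "cinner x y"]
    by (simp add: sgn_eq power2_eq_square divide_simps mult.commute)
  hence "cmod (cinner x y) \<le> norm x * norm (u *\<^sub>C y)"
    using Re_cinner_le[of x "u *\<^sub>C y"] by simp
  thus ?thesis
    by (simp add: norm_scaleC u)
qed simp

lemma bounded_linear_cinner_right: "bounded_linear (\<lambda>y. cinner x (y::'a::complex_inner))"
  by (rule bounded_linear_intro[where K = "norm x"])
    (auto simp: cinner_add_right cinner_scaleR_right scaleR_conv_of_real mult.commute cmod_cinner_le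
      intro: order_trans[OF cmod_cinner_le])

lemma bounded_linear_cinner_left: "bounded_linear (\<lambda>x. cinner x (y::'a::complex_inner))"
  by (rule bounded_linear_intro[where K = "norm y"])
    (auto simp: cinner_add_left cinner_scaleR_left scaleR_conv_of_real cmod_cinner_le)

lemmas cinner_diff_right = linear_diff[OF bounded_linear.linear[OF bounded_linear_cinner_right]]
lemmas cinner_diff_left = linear_diff[OF bounded_linear.linear[OF bounded_linear_cinner_left]]
lemmas cinner_zero_right [simp] = linear_0[OF bounded_linear.linear[OF bounded_linear_cinner_right]]
lemmas cinner_zero_left [simp] = linear_0[OF bounded_linear.linear[OF bounded_linear_cinner_left]]
lemmas cinner_sum_left = linear_sum[OF bounded_linear.linear[OF bounded_linear_cinner_left]]
lemmas cinner_sum_right = linear_sum[OF bounded_linear.linear[OF bounded_linear_cinner_right]]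
lemmas tendsto_cinner_right = bounded_linear.tendsto[OF bounded_linear_cinner_right]
lemmas tendsto_cinner_left = bounded_linear.tendsto[OF bounded_linear_cinner_left]

lemma norm_diff_sq: "(norm (x - y))\<^sup>2 = (norm x)\<^sup>2 - 2 * Re (cinner x y) + (norm (y::'a::complex_inner))\<^sup>2"
  using Re_cinner_commute[of x y]
  by (simp add: Re_cinner_self[symmetric] cinner_diff_left cinner_diff_right)

lemma cinner_eqI: "(\<And>z. cinner z x = cinner z y) \<Longrightarrow> x = (y::'a::complex_inner)"
  by (metis cinner_diff_right cinner_eq_zero_iff eq_iff_diff_eq_0)

lemma cinner_zero_commute: "cinner x y = 0 \<longleftrightarrow> cinner y (x::'a::complex_inner) = 0"
  by (metis cinner_commute complex_cnj_zero)

lemma clinearD: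
  assumes "clinear T"
  shows "T (x + y) = T x + T y" "T (a *\<^sub>C x) = a *\<^sub>C T x" "T (r *\<^sub>R x) = r *\<^sub>R T x"
  using assms by (auto simp: clinear_def scaleR_scaleC)

lemma bops_clinear: "T \<in> bops \<Longrightarrow> clinear T"
  by (simp add: bops_def)

lemma bops_bounded_linear: "T \<in> bops \<Longrightarrow> bounded_linear T"
  by (auto simp: bops_def clinearD intro: bounded_linear_intro)

lemmas bops_linear = bounded_linear.linear[OF bops_bounded_linear]

lemma bopsI: "clinear T \<Longrightarrow> bounded_linear T \<Longrightarrow> T \<in> bops"
  using bounded_linear.bounded by (auto simp: bops_def)

lemma id_bops: "id \<in> bops"
  by (auto simp: bops_def clinear_def intro: exI[of _ 1])

section \<open>Closed subspaces and orthogonal projections\<close>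

definition closed_csubspace :: "'a::complex_inner set \<Rightarrow> bool" where
  "closed_csubspace M \<longleftrightarrow> closed M \<and> 0 \<in> M \<and> (\<forall>x\<in>M. \<forall>y\<in>M. x + y \<in> M) \<and> (\<forall>c. \<forall>x\<in>M. c *\<^sub>C x \<in> M)"

lemma closed_csubspaceD:
  assumes "closed_csubspace M"
  shows "closed M" "0 \<in> M" "x \<in> M \<Longrightarrow> y \<in> M \<Longrightarrow> x + y \<in> M" "x \<in> M \<Longrightarrow> c *\<^sub>C x \<in> M"
    "x \<in> M \<Longrightarrow> r *\<^sub>R x \<in> M" "x \<in> M \<Longrightarrow> y \<in> M \<Longrightarrow> x - y \<in> M"
proof -
  show "closed M" "0 \<in> M" "x \<in> M \<Longrightarrow> y \<in> M \<Longrightarrow> x + y \<in> M" "x \<in> M \<Longrightarrow> c *\<^sub>C x \<in> M"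
    "x \<in> M \<Longrightarrow> r *\<^sub>R x \<in> M" for c x y r
    using assms by (auto simp: closed_csubspace_def scaleR_scaleC)
  from this(3)[of x "(-1) *\<^sub>C y"] this(4)[of y "-1"] show "x \<in> M \<Longrightarrow> y \<in> M \<Longrightarrow> x - y \<in> M"
    by (simp add: scaleC_minus_one)
qed

lemma closest_point_orthogonal:
  fixes M :: "'a::complex_inner set"
  assumes M: "closed_csubspace M" and y: "y \<in> M" and min: "\<And>w. w \<in> M \<Longrightarrow> norm (x - y) \<le> norm (x - w)"
    and z: "z \<in> M"
  shows "cinner z (x - y) = 0"
proof -
  have re: "Re (cinner z (x - y)) = 0" if z: "z \<in> M" for z
  proof (cases "z = 0")
    case False
    define s where "s = Re (cinner z (x - y))"
    \<comment> \<open>This \<open>t\<close> minimises the quadratic polynomial giving the squared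
      distance from \<open>x\<close> to \<open>y + t *\<^sub>R z\<close>.\<close>
    define t where "t = s / (norm z)\<^sup>2"
    have nz: "norm z \<noteq> 0" using False by simp
    have "norm (x - y) \<le> norm (x - (y + t *\<^sub>R z))"
      by (intro min closed_csubspaceD[OF M] y z)
    hence "(norm (x - y))\<^sup>2 \<le> (norm (t *\<^sub>R z - (x - y)))\<^sup>2"
      by (intro power_mono) (auto simp: algebra_simps norm_minus_commute)
    also have "\<dots> = t\<^sup>2 * (norm z)\<^sup>2 - 2 * (t * s) + (norm (x - y))\<^sup>2"
      by (simp add: norm_diff_sq[of "t *\<^sub>R z"] cinner_scaleR_left s_def power_mult_distrib)
    finally have "2 * (t * s) \<le> t\<^sup>2 * (norm z)\<^sup>2" by simp
    moreover have "t\<^sup>2 * (norm z)\<^sup>2 = t * s"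
      using nz by (simp add: t_def power2_eq_square)
    moreover have "t * s = s\<^sup>2 / (norm z)\<^sup>2" by (simp add: t_def power2_eq_square)
    ultimately have "s\<^sup>2 / (norm z)\<^sup>2 \<le> 0" by simp
    hence "s = 0" using nz by (simp add: divide_le_0_iff)
    thus ?thesis by (simp add: s_def)
  qed simp
  \<comment> \<open>Conjugate linearity in the first argument turns the real part at
    \<open>\<i> *\<^sub>C z\<close> into the imaginary part at \<open>z\<close>.\<close>
  have "Re (cinner (\<i> *\<^sub>C z) (x - y)) = 0"
    by (intro re closed_csubspaceD[OF M] z)
  with re[OF z] show ?thesis
    by (simp add: cinner_scaleC_left complex_eq_iff)
qed

theorem projection_theorem:
  fixes M :: "'a::chilbert_space set"
  assumes M: "closed_csubspace M"
  shows "\<exists>y\<in>M. \<forall>z\<in>M. cinner z (x - y) = 0"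
proof -
  define d where "d = Inf ((\<lambda>y. norm (x - y)) ` M)"
  have ne: "M \<noteq> {}" using closed_csubspaceD(2)[OF M] by auto
  have bdd: "bdd_below ((\<lambda>y. norm (x - y)) ` M)" by (rule bdd_belowI2[of _ 0]) simp
  have d_le: "d \<le> norm (x - y)" if "y \<in> M" for y
    unfolding d_def by (rule cINF_lower[OF bdd that])
  have d0: "0 \<le> d" unfolding d_def by (rule cINF_greatest[OF ne]) simp
  have "\<exists>y\<in>M. norm (x - y) < d + 1 / real (Suc n)" for n
  proof -
    have "Inf ((\<lambda>y. norm (x - y)) ` M) < d + 1 / real (Suc n)" by (simp add: d_def)
    from cInf_lessD[OF _ this] ne show ?thesis by auto
  qed
  then obtain y where yM: "\<And>n. y n \<in> M" and yd: "\<And>n. norm (x - y n) < d + 1 / real (Suc n)"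
    by metis
  have lim: "(\<lambda>n. norm (x - y n)) \<longlonglongrightarrow> d"
  proof (rule tendsto_sandwich[of "\<lambda>_. d" _ _ "\<lambda>n. d + 1 / real (Suc n)"])
    have "(\<lambda>n. d + 1 / real (Suc n)) \<longlonglongrightarrow> d + 0"
      by (intro tendsto_add tendsto_const) (rule LIMSEQ_Suc, rule lim_1_over_n)
    thus "(\<lambda>n. d + 1 / real (Suc n)) \<longlonglongrightarrow> d" by simp
  qed (use yM yd d_le in \<open>auto intro!: always_eventually less_imp_le\<close>)
  \<comment> \<open>Parallelogram law: the midpoint of \<open>y m\<close> and \<open>y n\<close>
    lies in \<open>M\<close>, hence is at distance at least \<open>d\<close> from \<open>x\<close>.
    This makes any minimising sequence Cauchy.\<close>
  have par: "(norm (y m - y n))\<^sup>2 \<le> 2 * ((norm (x - y m))\<^sup>2 - d\<^sup>2) + 2 * ((norm (x - y n))\<^sup>2 - d\<^sup>2)" for m n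
  proof -
    define u v where "u = x - y m" and "v = x - y n"
    have "d \<le> norm (x - (1/2) *\<^sub>R (y m + y n))"
      by (intro d_le closed_csubspaceD[OF M] yM)
    also have "x - (1/2) *\<^sub>R (y m + y n) = (1/2) *\<^sub>R (u + v)"
      by (simp add: u_def v_def algebra_simps flip: scaleR_add_left)
    finally have "2 * d \<le> norm (u + v)" by simp
    hence "(2 * d)\<^sup>2 \<le> (norm (u + v))\<^sup>2" using d0 by (intro power_mono) auto
    moreover have "(norm (y m - y n))\<^sup>2 = (norm (u - v))\<^sup>2"
      by (simp add: u_def v_def norm_minus_commute)
    ultimately show ?thesis
      unfolding u_def[symmetric] v_def[symmetric] by (simp add: norm_add_sq norm_diff_sq power_mult_distrib)
  qed
  have "Cauchy y"
  proof (rule CauchyI)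
    fix e :: real assume e: "e > 0"
    have "(\<lambda>n. (norm (x - y n))\<^sup>2 - d\<^sup>2) \<longlonglongrightarrow> d\<^sup>2 - d\<^sup>2"
      by (intro tendsto_intros lim)
    hence "\<forall>\<^sub>F n in sequentially. (norm (x - y n))\<^sup>2 - d\<^sup>2 < e\<^sup>2 / 4"
      using e by (intro order_tendstoD(2)) auto
    then obtain N where N: "\<And>n. n \<ge> N \<Longrightarrow> (norm (x - y n))\<^sup>2 - d\<^sup>2 < e\<^sup>2 / 4"
      by (auto simp: eventually_sequentially)
    have "norm (y m - y n) < e" if "m \<ge> N" "n \<ge> N" for m n
    proof -
      have "(norm (y m - y n))\<^sup>2 < e\<^sup>2"
        using par[of m n] N[OF that(1)] N[OF that(2)] by (simp add: field_simps)
      thus ?thesis using e power2_less_imp_less[of "norm (y m - y n)" e] by simp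
    qed
    thus "\<exists>N. \<forall>m\<ge>N. \<forall>n\<ge>N. norm (y m - y n) < e" by blast
  qed
  then obtain l where l: "y \<longlonglongrightarrow> l" using Cauchy_convergent_iff convergent_def by blast
  have lM: "l \<in> M"
    using closed_sequentially[OF closed_csubspaceD(1)[OF M]] yM l by blast
  have "(\<lambda>n. norm (x - y n)) \<longlonglongrightarrow> norm (x - l)" by (intro tendsto_intros l)
  with lim have "norm (x - l) = d" using LIMSEQ_unique by blast
  with closest_point_orthogonal[OF M lM, of x] d_le lM show ?thesis by auto
qed

lemma orthogonal_decomposition_unique:
  fixes M :: "'a::complex_inner set"
  assumes M: "closed_csubspace M" and "y \<in> M" "y' \<in> M"
    and "\<And>z. z \<in> M \<Longrightarrow> cinner z (x - y) = 0" "\<And>z. z \<in> M \<Longrightarrow> cinner z (x - y') = 0"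
  shows "y = y'"
proof -
  have "y - y' \<in> M" using assms closed_csubspaceD(6) by blast
  hence "cinner (y - y') ((x - y') - (x - y)) = 0"
    by (subst cinner_diff_right) (simp add: assms)
  thus ?thesis by (simp add: cinner_eq_zero_iff)
qed

definition orth_proj :: "'a::chilbert_space set \<Rightarrow> 'a \<Rightarrow> 'a" where
  "orth_proj M x = (THE y. y \<in> M \<and> (\<forall>z\<in>M. cinner z (x - y) = 0))"

lemma orth_proj_eqI:
  assumes "closed_csubspace M" "y \<in> M" "\<And>z. z \<in> M \<Longrightarrow> cinner z (x - y) = 0"
  shows "orth_proj M x = y"
  unfolding orth_proj_def using assms orthogonal_decomposition_unique[OF assms(1)]
  by (intro the_equality) blast+

lemma
  assumes M: "closed_csubspace M"
  shows orth_proj_in: "orth_proj M x \<in> M"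
    and orth_proj_orth: "z \<in> M \<Longrightarrow> cinner z (x - orth_proj M x) = 0"
  using projection_theorem[OF M, of x] orth_proj_eqI[OF M] by force+

lemma orth_proj_fixes_iff:
  assumes M: "closed_csubspace M"
  shows "orth_proj M x = x \<longleftrightarrow> x \<in> M"
  using orth_proj_in[OF M, of x] orth_proj_eqI[OF M, of x x] by auto

lemma adj_eqI: "(\<And>x y. cinner (T x) y = cinner x (S y)) \<Longrightarrow> adj T = S"
  unfolding adj_def by (rule the_equality) (blast, metis ext cinner_eqI)

lemma clinear_orth_proj:
  assumes M: "closed_csubspace M"
  shows "clinear (orth_proj M)"
  unfolding clinear_def
proof (intro conjI allI)
  fix x y a
  note D = closed_csubspaceD[OF M] orth_proj_in[OF M]
  show "orth_proj M (x + y) = orth_proj M x + orth_proj M y"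
    using orth_proj_orth[OF M] by (intro orth_proj_eqI D M) (auto simp: add_diff_add cinner_add_right)
  have "a *\<^sub>C x - a *\<^sub>C orth_proj M x = a *\<^sub>C (x - orth_proj M x)"
    using scaleC_add_right[of a "x - orth_proj M x" "orth_proj M x"] by simp
  thus "orth_proj M (a *\<^sub>C x) = a *\<^sub>C orth_proj M x"
    using orth_proj_orth[OF M] by (intro orth_proj_eqI D M) (auto simp: cinner_scaleC_right)
qed

lemma norm_orth_proj_le:
  assumes M: "closed_csubspace M"
  shows "norm (orth_proj M x) \<le> norm x"
proof -
  have "(norm (orth_proj M x + (x - orth_proj M x)))\<^sup>2 \<ge> (norm (orth_proj M x))\<^sup>2"
    unfolding norm_add_sq using orth_proj_orth[OF M orth_proj_in[OF M]] by simp
  thus ?thesis using power2_le_imp_le[of "norm (orth_proj M x)" "norm x"] by simp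
qed

lemma cinner_orth_proj:
  assumes M: "closed_csubspace M"
  shows "cinner (orth_proj M x) y = cinner x (orth_proj M y)"
proof -
  have "cinner (orth_proj M x) y = cinner (orth_proj M x) (orth_proj M y)"
    using orth_proj_orth[OF M orth_proj_in[OF M], of x y] by (simp add: cinner_diff_right)
  moreover have "cinner x (orth_proj M y) = cinner (orth_proj M x) (orth_proj M y)"
    using orth_proj_orth[OF M orth_proj_in[OF M], of y x] cinner_zero_commute
    by (metis cinner_diff_left eq_iff_diff_eq_0)
  ultimately show ?thesis by simp
qed

lemma is_projection_orth_proj:
  assumes M: "closed_csubspace M"
  shows "is_projection (orth_proj M)"
proof -
  have "orth_proj M \<in> bops"
    unfolding bops_def using clinear_orth_proj[OF M] norm_orth_proj_le[OF M]
    by (auto intro!: exI[of _ 1])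
  moreover have "orth_proj M \<circ> orth_proj M = orth_proj M"
    using orth_proj_in[OF M] orth_proj_fixes_iff[OF M] by (auto simp: fun_eq_iff)
  moreover have "adj (orth_proj M) = orth_proj M"
    by (rule adj_eqI) (rule cinner_orth_proj[OF M])
  ultimately show ?thesis by (simp add: is_projection_def)
qed

subsection \<open>Adjoints\<close>

text \<open>The kernel is a closed hyperplane; the component \<open>w\<close> of \<open>x0\<close>
  orthogonal to it represents the functional after rescaling.\<close>

lemma riesz_representation:
  fixes \<phi> :: "'a::chilbert_space \<Rightarrow> complex"
  assumes add: "\<And>x y. \<phi> (x + y) = \<phi> x + \<phi> y" and scale: "\<And>a x. \<phi> (a *\<^sub>C x) = a * \<phi> x"
    and bl: "bounded_linear \<phi>"
  shows "\<exists>w. \<forall>x. \<phi> x = cinner w x"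
proof (cases "\<forall>x. \<phi> x = 0")
  case True
  thus ?thesis by (intro exI[of _ 0]) simp
next
  case False
  then obtain x0 where x0: "\<phi> x0 \<noteq> 0" by auto
  define M where "M = {x. \<phi> x = 0}"
  have cl: "closed M"
  proof -
    have "M = \<phi> -` {0}" by (auto simp: M_def)
    thus ?thesis
      using bl by (auto intro!: continuous_closed_vimage linear_continuous_at)
  qed
  have M: "closed_csubspace M"
    unfolding closed_csubspace_def using cl linear_0[OF bounded_linear.linear[OF bl]]
    by (auto simp: M_def add scale)
  define w where "w = x0 - orth_proj M x0"
  have w_phi: "\<phi> w = \<phi> x0"
    using orth_proj_in[OF M, of x0] linear_diff[OF bounded_linear.linear[OF bl]] by (simp add: w_def M_def)
  have w0: "w \<noteq> 0" using w_phi x0 linear_0[OF bounded_linear.linear[OF bl]] by auto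
  have "cinner (cnj (\<phi> w / of_real ((norm w)\<^sup>2)) *\<^sub>C w) x = \<phi> x" for x
  proof -
    have "x - (\<phi> x / \<phi> w) *\<^sub>C w \<in> M"
      using x0 w_phi linear_diff[OF bounded_linear.linear[OF bl]] by (simp add: M_def scale)
    hence "cinner w (x - (\<phi> x / \<phi> w) *\<^sub>C w) = 0"
      using orth_proj_orth[OF M, of _ x0] cinner_zero_commute unfolding w_def by blast
    hence "cinner w x = (\<phi> x / \<phi> w) * of_real ((norm w)\<^sup>2)"
      by (simp add: cinner_diff_right cinner_scaleC_right cinner_self)
    thus ?thesis using w0 x0 w_phi by (simp add: cinner_scaleC_left)
  qed
  thus ?thesis by metis
qed

text \<open>\<open>adj\<close> is a definite description; the Riesz theorem supplies a witness for
  every bounded operator.\<close>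

lemma cinner_adj:
  assumes T: "T \<in> bops"
  shows "cinner (T x) y = cinner x (adj T y)"
proof -
  have "\<exists>w. \<forall>x. cinner y (T x) = cinner w x" for y
    by (rule riesz_representation)
      (auto simp: clinearD[OF bops_clinear[OF T]] cinner_add_right cinner_scaleC_right
       intro: bounded_linear_compose[OF bounded_linear_cinner_right bops_bounded_linear[OF T]])
  then obtain S where S: "\<And>x y. cinner y (T x) = cinner (S y) x" by metis
  have "cinner (T x) y = cinner x (S y)" for x y
    using S[of y x] cinner_commute by metis
  moreover from this have "adj T = S" by (rule adj_eqI)
  ultimately show ?thesis by simp
qed

lemma cinner_adj_left:
  assumes T: "T \<in> bops"
  shows "cinner x (T y) = cinner (adj T x) y"
  using cinner_adj[OF T, of y x] cinner_commute by metis

lemma adj_bops: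
  assumes T: "T \<in> bops"
  shows "adj T \<in> bops"
proof -
  note c = cinner_adj[OF T, symmetric]
  have lin: "clinear (adj T)"
    unfolding clinear_def
  proof (intro conjI allI)
    show "adj T (x + y) = adj T x + adj T y" for x y
      by (rule cinner_eqI) (simp only: cinner_add_right c)
    show "adj T (a *\<^sub>C x) = a *\<^sub>C adj T x" for a x
      by (rule cinner_eqI) (simp only: cinner_scaleC_right c)
  qed
  obtain K where K: "\<And>x. norm (T x) \<le> norm x * K" and K0: "K > 0"
    using bounded_linear.pos_bounded[OF bops_bounded_linear[OF T]] by auto
  have "norm (adj T y) \<le> norm y * K" for y
  proof (cases "adj T y = 0")
    case False
    have "(norm (adj T y))\<^sup>2 = Re (cinner (T (adj T y)) y)"
      by (simp add: cinner_adj[OF T] Re_cinner_self)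
    also have "\<dots> \<le> norm (T (adj T y)) * norm y" by (rule Re_cinner_le)
    also have "\<dots> \<le> norm (adj T y) * K * norm y" by (intro mult_right_mono K) simp
    finally show ?thesis using False by (simp add: power2_eq_square mult.commute)
  qed (use K0 in simp)
  with lin show ?thesis by (auto simp: bops_def)
qed

text \<open>Invariance of \<open>M\<close> under \<open>adj T\<close> is invariance of its
  orthogonal complement under \<open>T\<close>, so \<open>T\<close> respects the whole
  decomposition.\<close>

lemma orth_proj_commute:
  assumes M: "closed_csubspace M" and T: "T \<in> bops"
    and inv: "\<And>x. x \<in> M \<Longrightarrow> T x \<in> M" "\<And>x. x \<in> M \<Longrightarrow> adj T x \<in> M"
  shows "T (orth_proj M x) = orth_proj M (T x)"
proof -
  have "cinner z (T x - T (orth_proj M x)) = 0" if "z \<in> M" for z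
    using orth_proj_orth[OF M inv(2)[OF that]]
    unfolding linear_diff[OF bops_linear[OF T], symmetric] cinner_adj_left[OF T] .
  thus ?thesis
    using orth_proj_eqI[OF M inv(1)[OF orth_proj_in[OF M]]] by metis
qed

lemma cinner_hermitian:
  assumes "T \<in> bops" "adj T = T"
  shows "cinner (T x) y = cinner x (T y)"
  using cinner_adj[OF assms(1)] assms(2) by simp

section \<open>Projections as operators, and their order\<close>

lemma is_projectionD:
  assumes "is_projection P"
  shows "P \<in> bops" "P (P x) = P x" "cinner (P x) y = cinner x (P y)" "linear P"
proof -
  from assms show P: "P \<in> bops" and "P (P x) = P x"
    by (auto simp: is_projection_def fun_eq_iff)
  show "cinner (P x) y = cinner x (P y)"
    using assms by (intro cinner_hermitian) (auto simp: is_projection_def)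
  show "linear P" by (rule bops_linear[OF P])
qed

lemma is_projectionI:
  assumes "P \<in> bops" "\<And>x. P (P x) = P x" "\<And>x y. cinner (P x) y = cinner x (P y)"
  shows "is_projection P"
  unfolding is_projection_def using assms(1,2) adj_eqI[of P P, OF assms(3)] by auto

lemma norm_projection_split:
  assumes "is_projection P"
  shows "(norm x)\<^sup>2 = (norm (P x))\<^sup>2 + (norm (x - P x))\<^sup>2"
proof -
  have "cinner (P x) (x - P x) = 0"
    unfolding is_projectionD(3)[OF assms] linear_diff[OF is_projectionD(4)[OF assms]]
    by (simp add: is_projectionD(2)[OF assms])
  thus ?thesis using norm_add_sq[of "P x" "x - P x"] by simp
qed

lemma norm_projection_le: "is_projection P \<Longrightarrow> norm (P x) \<le> norm x"
  using norm_projection_split[of P x] power2_le_imp_le[of "norm (P x)" "norm x"] by simp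

lemma is_projection_compl:
  assumes P: "is_projection P"
  shows "is_projection (\<lambda>x. x - P x)"
proof (rule is_projectionI)
  note D = is_projectionD[OF P]
  have [simp]: "a *\<^sub>C x - a *\<^sub>C y = a *\<^sub>C (x - y)" for a and x y :: 'a
    using scaleC_add_right[of a "x - y" y] by simp
  have "clinear (\<lambda>x. x - P x)"
    by (auto simp: clinear_def clinearD[OF bops_clinear[OF D(1)]])
  thus "(\<lambda>x. x - P x) \<in> bops"
    by (rule bopsI) (intro bounded_linear_sub bounded_linear_ident bops_bounded_linear[OF D(1)])
  show "x - P x - P (x - P x) = x - P x" for x
    by (simp add: linear_diff[OF D(4)] D(2))
  show "cinner (x - P x) y = cinner x (y - P y)" for x y
    by (simp add: cinner_diff_left cinner_diff_right D(3))
qed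

lemma is_projection_id: "is_projection id"
  by (rule is_projectionI) (auto simp: id_bops)

text \<open>Taking adjoints turns \<open>P \<circ> Q = P\<close> into
  \<open>Q \<circ> P = P\<close>, which is inclusion of ranges.\<close>

lemma proj_le_iff:
  assumes P: "is_projection P" and Q: "is_projection Q"
  shows "proj_le P Q \<longleftrightarrow> (\<forall>x. Q (P x) = P x)"
proof
  assume "proj_le P Q"
  hence "P (Q x) = P x" for x by (simp add: proj_le_def fun_eq_iff)
  thus "\<forall>x. Q (P x) = P x"
    by (intro allI cinner_eqI) (metis is_projectionD(3)[OF P] is_projectionD(3)[OF Q])
next
  assume "\<forall>x. Q (P x) = P x"
  hence "P (Q x) = P x" for x
    by (intro cinner_eqI) (metis is_projectionD(3)[OF P] is_projectionD(3)[OF Q])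
  thus "proj_le P Q" by (auto simp: proj_le_def)
qed

lemma proj_le_fixes:
  assumes P: "is_projection P" and Q: "is_projection Q"
  shows "proj_le P Q \<longleftrightarrow> (\<forall>x. P x = x \<longrightarrow> Q x = x)"
  unfolding proj_le_iff[OF assms] using is_projectionD(2)[OF P] by metis

lemma proj_le_antisym:
  assumes P: "is_projection P" and Q: "is_projection Q" and "proj_le P Q" "proj_le Q P"
  shows "P = Q"
  using assms(3,4) unfolding proj_le_iff[OF Q P] unfolding proj_le_def by (simp add: fun_eq_iff)

lemma proj_le_trans: "proj_le P Q \<Longrightarrow> proj_le Q S \<Longrightarrow> proj_le P S"
  unfolding proj_le_def by (metis comp_assoc)

lemma proj_le_refl: "is_projection P \<Longrightarrow> proj_le P P"
  by (simp add: proj_le_def is_projection_def)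

lemma closed_csubspace_kernel:
  assumes T: "T \<in> bops"
  shows "closed_csubspace {x. T x = 0}"
proof -
  have "closed (T -` {0})"
    using bops_bounded_linear[OF T] by (auto intro!: continuous_closed_vimage linear_continuous_at)
  moreover have "T -` {0} = {x. T x = 0}" by auto
  ultimately show ?thesis
    using linear_0[OF bops_linear[OF T]]
    by (auto simp: closed_csubspace_def clinearD[OF bops_clinear[OF T]])
qed

lemma closed_csubspace_range:
  assumes P: "is_projection P"
  shows "closed_csubspace {x. P x = x}"
proof -
  have "{x. P x = x} = {x. x - P x = 0}" by (metis eq_iff_diff_eq_0)
  thus ?thesis
    using closed_csubspace_kernel[OF is_projectionD(1)[OF is_projection_compl[OF P]]] by simp
qed

lemma closed_csubspace_INT:
  "(\<And>i. i \<in> I \<Longrightarrow> closed_csubspace (M i)) \<Longrightarrow> closed_csubspace (\<Inter>i\<in>I. M i)"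
  unfolding closed_csubspace_def by (intro conjI closed_INT) auto

section \<open>Projections in von Neumann algebras\<close>

lemma commutant_bops: "T \<in> commutant S \<Longrightarrow> T \<in> bops"
  by (simp add: commutant_def)

lemma commutantD: "T \<in> commutant S \<Longrightarrow> A \<in> S \<Longrightarrow> T (A x) = A (T x)"
  by (auto simp: commutant_def fun_eq_iff)

lemma commutantI: "T \<in> bops \<Longrightarrow> (\<And>A x. A \<in> S \<Longrightarrow> T (A x) = A (T x)) \<Longrightarrow> T \<in> commutant S"
  by (auto simp: commutant_def fun_eq_iff)

lemma adj_commutant:
  assumes R: "R \<subseteq> bops" "\<And>A. A \<in> R \<Longrightarrow> adj A \<in> R" and T: "T \<in> commutant R"
  shows "adj T \<in> commutant R"
proof (rule commutantI)
  note Tb = commutant_bops[OF T]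
  show "adj T \<in> bops" by (rule adj_bops[OF Tb])
  fix A x assume A: "A \<in> R"
  hence Ab: "A \<in> bops" using R by auto
  show "adj T (A x) = A (adj T x)"
  proof (rule cinner_eqI)
    fix z
    have "cinner z (adj T (A x)) = cinner (adj A (T z)) x"
      by (metis cinner_adj[OF Tb] cinner_adj_left[OF Ab])
    also have "adj A (T z) = T (adj A z)" using commutantD[OF T R(2)[OF A]] by simp
    also have "cinner (T (adj A z)) x = cinner z (A (adj T x))"
      by (metis cinner_adj[OF Tb] cinner_adj_left[OF Ab])
    finally show "cinner z (adj T (A x)) = cinner z (A (adj T x))" .
  qed
qed

context
  fixes R :: "('h::chilbert_space \<Rightarrow> 'h) set"
  assumes vN: "von_neumann_algebra R"
begin

lemma vN_bops: "A \<in> R \<Longrightarrow> A \<in> bops"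
  using vN by (auto simp: von_neumann_algebra_def)

lemma vN_adj: "A \<in> R \<Longrightarrow> adj A \<in> R"
  using vN by (auto simp: von_neumann_algebra_def)

lemma vN_iff: "A \<in> R \<longleftrightarrow> A \<in> bops \<and> (\<forall>T\<in>commutant R. \<forall>x. T (A x) = A (T x))"
proof -
  have "R = commutant (commutant R)" using vN by (simp add: von_neumann_algebra_def)
  thus ?thesis by (auto simp: commutant_def fun_eq_iff)
qed

lemma projections_iff:
  "P \<in> projections R \<longleftrightarrow> is_projection P \<and> (\<forall>T\<in>commutant R. \<forall>x. T (P x) = P (T x))"
  unfolding projections_def using is_projectionD(1) vN_iff by auto

lemma projectionsD: "P \<in> projections R \<Longrightarrow> is_projection P"
  by (simp add: projections_def)

text \<open>By the bicommutant property, an operator lies in \<open>R\<close> once it commutes with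
  the commutant. The commutant is closed under adjoints, so plain invariance of \<open>M\<close>
  already gives commutation.\<close>

lemma orth_proj_in_vN:
  assumes M: "closed_csubspace M" and inv: "\<And>T x. T \<in> commutant R \<Longrightarrow> x \<in> M \<Longrightarrow> T x \<in> M"
  shows "orth_proj M \<in> projections R"
  unfolding projections_iff
proof (intro conjI ballI allI is_projection_orth_proj[OF M])
  fix T x assume T: "T \<in> commutant R"
  hence "adj T \<in> commutant R" using vN_bops vN_adj by (intro adj_commutant) auto
  thus "T (orth_proj M x) = orth_proj M (T x)"
    using T inv by (intro orth_proj_commute[OF M commutant_bops[OF T]]) auto
qed

lemma projections_compl:
  assumes P: "P \<in> projections R"
  shows "(\<lambda>x. x - P x) \<in> projections R"
  using P is_projection_compl linear_diff[OF bops_linear[OF commutant_bops]]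
  by (auto simp: projections_iff)

lemma projections_id: "id \<in> projections R"
  using is_projection_id by (auto simp: projections_iff)

lemma projections_range_invariant:
  "P \<in> projections R \<Longrightarrow> T \<in> commutant R \<Longrightarrow> P x = x \<Longrightarrow> P (T x) = T x"
  unfolding projections_iff by metis

lemma orth_proj_range_INT:
  assumes "\<And>i. i \<in> I \<Longrightarrow> P i \<in> projections R"
  shows "orth_proj (\<Inter>i\<in>I. {x. P i x = x}) \<in> projections R"
proof (rule orth_proj_in_vN)
  show "closed_csubspace (\<Inter>i\<in>I. {x. P i x = x})"
    using assms projectionsD by (intro closed_csubspace_INT closed_csubspace_range) auto
qed (use assms projections_range_invariant in auto)

text \<open>The meet is the projection onto the intersection of the ranges; it stays in
  \<open>R\<close> because the commutant preserves both ranges. This settles the definite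
  description in \<open>proj_meet\<close>.\<close>

lemma
  assumes P: "P \<in> projections R" and Q: "Q \<in> projections R"
  shows proj_meet_in: "proj_meet R P Q \<in> projections R"
    and proj_meet_fixes: "proj_meet R P Q x = x \<longleftrightarrow> P x = x \<and> Q x = x"
proof -
  define M where "M = (\<Inter>S\<in>{P, Q}. {x. S x = x})"
  have M: "closed_csubspace M"
    unfolding M_def using P Q projectionsD by (intro closed_csubspace_INT closed_csubspace_range) auto
  have S: "orth_proj M \<in> projections R"
    using orth_proj_range_INT[of "{P, Q}" "\<lambda>S. S"] P Q unfolding M_def by auto
  note pr = projectionsD[OF P] projectionsD[OF Q] projectionsD[OF S]
  have fix_S: "orth_proj M x = x \<longleftrightarrow> P x = x \<and> Q x = x" for x
    unfolding orth_proj_fixes_iff[OF M] by (auto simp: M_def)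
  have *: "proj_le T (orth_proj M) \<longleftrightarrow> proj_le T P \<and> proj_le T Q" if "T \<in> projections R" for T
    using fix_S by (auto simp: proj_le_fixes pr projectionsD[OF that])
  have "proj_meet R P Q = orth_proj M"
    unfolding proj_meet_def
  proof (rule the_equality)
    show S_glb: "orth_proj M \<in> projections R \<and> proj_le (orth_proj M) P \<and> proj_le (orth_proj M) Q \<and>
      (\<forall>T\<in>projections R. proj_le T P \<and> proj_le T Q \<longrightarrow> proj_le T (orth_proj M))"
      using S * proj_le_refl[OF pr(3)] by auto
    show "S' = orth_proj M" if "S' \<in> projections R \<and> proj_le S' P \<and> proj_le S' Q \<and>
      (\<forall>T\<in>projections R. proj_le T P \<and> proj_le T Q \<longrightarrow> proj_le T S')" for S'
      using that S_glb by (intro proj_le_antisym projectionsD) auto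
  qed
  with S fix_S show "proj_meet R P Q \<in> projections R" "proj_meet R P Q x = x \<longleftrightarrow> P x = x \<and> Q x = x"
    by auto
qed

lemma proj_le_meet_iff:
  assumes "P \<in> projections R" "Q \<in> projections R" "T \<in> projections R"
  shows "proj_le T (proj_meet R P Q) \<longleftrightarrow> proj_le T P \<and> proj_le T Q"
  using proj_meet_fixes[OF assms(1,2)] assms projectionsD proj_meet_in[OF assms(1,2)]
  by (auto simp: proj_le_fixes)

lemma proj_meet_le:
  assumes "P \<in> projections R" "Q \<in> projections R"
  shows "proj_le (proj_meet R P Q) P" "proj_le (proj_meet R P Q) Q"
  using proj_meet_fixes[OF assms] assms projectionsD proj_meet_in[OF assms]
  by (auto simp: proj_le_fixes)

end

section \<open>Monotone families of projections\<close>

locale projection_family =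
  fixes E :: "real \<Rightarrow> 'h::chilbert_space \<Rightarrow> 'h"
  assumes proj: "is_projection (E l)" and mono: "l \<le> m \<Longrightarrow> proj_le (E l) (E m)"
begin

lemmas E_bops = is_projectionD(1)[OF proj]
lemmas E_linear = is_projectionD(4)[OF proj]
lemmas E_bounded_linear = bops_bounded_linear[OF E_bops]
lemmas E_linear_simps = linear_diff[OF E_linear] linear_0[OF E_linear] linear_sum[OF E_linear]
  linear_scale[OF E_linear] linear_add[OF E_linear]

lemma E_absorb: "l \<le> m \<Longrightarrow> E l (E m x) = E l x" "l \<le> m \<Longrightarrow> E m (E l x) = E l x"
  using mono[of l m] proj_le_iff[OF proj[of l] proj[of m]] by (auto simp: proj_le_def fun_eq_iff)

lemma E_commute: "E l (E m x) = E m (E l x)"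
  by (cases "l \<le> m") (simp_all add: E_absorb)

lemma norm_diff_E: "l \<le> m \<Longrightarrow> (norm (E m x - E l x))\<^sup>2 = (norm (E m x))\<^sup>2 - (norm (E l x))\<^sup>2"
  using norm_projection_split[OF proj[of l], of "E m x"] by (simp add: E_absorb)

text \<open>As \<open>m\<close> decreases to \<open>l\<close>, the squared norms of
  \<open>E m x\<close> decrease, and by Pythagoras their gaps are the squared distances, so a limit
  exists. It lies in every range with \<open>m > l\<close>, hence by \<open>inter\<close> in that of
  \<open>E l\<close>, where it can only be \<open>E l x\<close>.\<close>

lemma strongly_right_continuous:
  assumes inter: "\<And>x. (\<And>m. m > l \<Longrightarrow> E m x = x) \<Longrightarrow> E l x = x"
  shows "((\<lambda>m. E m x) \<longlongrightarrow> E l x) (at_right l)"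
proof -
  define g where "g m = (norm (E m x))\<^sup>2" for m
  define s where "s k = l + 1 / real (Suc k)" for k :: nat
  have s_gt: "s k > l" for k by (simp add: s_def)
  have s_lim: "s \<longlonglongrightarrow> l"
  proof -
    have "(\<lambda>k. l + 1 / real (Suc k)) \<longlonglongrightarrow> l + 0"
      by (intro tendsto_add tendsto_const) (rule LIMSEQ_Suc, rule lim_1_over_n)
    thus ?thesis unfolding s_def by simp
  qed
  have g_mono: "g m \<le> g n" if "m \<le> n" for m n
    using norm_diff_E[OF that, of x] unfolding g_def by (smt (verit) zero_le_power2)
  have "decseq (\<lambda>k. g (s k))"
    unfolding decseq_def s_def by (intro allI impI g_mono add_left_mono divide_left_mono) auto
  moreover have "\<forall>k. 0 \<le> g (s k)" by (simp add: g_def)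
  ultimately obtain L where L: "(\<lambda>k. g (s k)) \<longlonglongrightarrow> L"
    using decseq_convergent by blast
  have "Cauchy (\<lambda>k. E (s k) x)"
  proof (rule CauchyI)
    fix e :: real assume e: "e > 0"
    from LIMSEQ_imp_Cauchy[OF L] obtain N where
      N: "\<And>i j. i \<ge> N \<Longrightarrow> j \<ge> N \<Longrightarrow> norm (g (s i) - g (s j)) < e\<^sup>2"
      using CauchyD[of _ "e\<^sup>2"] e by (metis zero_less_power)
    have sq: "(norm (E i x - E j x))\<^sup>2 = norm (g i - g j)" for i j
    proof (cases "i \<le> j")
      case True
      thus ?thesis using norm_diff_E[OF True, of x] g_mono[OF True] by (simp add: g_def norm_minus_commute)
    next
      case False
      hence "j \<le> i" by simp
      thus ?thesis using norm_diff_E[of j i x] g_mono[of j i] by (simp add: g_def)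
    qed
    have "norm (E (s i) x - E (s j) x) < e" if "i \<ge> N" "j \<ge> N" for i j
      using power2_less_imp_less[of "norm (E (s i) x - E (s j) x)" e] N[OF that] e by (simp add: sq)
    thus "\<exists>N. \<forall>i\<ge>N. \<forall>j\<ge>N. norm (E (s i) x - E (s j) x) < e" by blast
  qed
  then obtain y where y: "(\<lambda>k. E (s k) x) \<longlonglongrightarrow> y"
    using Cauchy_convergent_iff convergent_def by blast
  have "E m y = y" if m: "m > l" for m
  proof -
    have "\<forall>\<^sub>F k in sequentially. s k < m" using s_lim m by (rule order_tendstoD(2))
    hence "\<forall>\<^sub>F k in sequentially. E (s k) x \<in> {z. E m z = z}"
      by eventually_elim (simp add: E_absorb)
    hence "y \<in> {z. E m z = z}"
      by (rule Lim_in_closed_set[OF closed_csubspaceD(1)[OF closed_csubspace_range[OF proj]] _ sequentially_bot y])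
    thus ?thesis by simp
  qed
  hence "E l y = y" by (rule inter)
  moreover have "(\<lambda>k. E l (E (s k) x)) \<longlonglongrightarrow> E l y"
    by (rule bounded_linear.tendsto[OF E_bounded_linear y])
  hence "(\<lambda>k. E l x) \<longlonglongrightarrow> E l y"
    unfolding E_absorb(1)[OF less_imp_le[OF s_gt]] .
  hence "E l y = E l x" by (simp add: LIMSEQ_const_iff)
  ultimately have y_eq: "y = E l x" by simp
  show ?thesis
  proof (rule tendstoI)
    fix e :: real assume e: "e > 0"
    have "\<forall>\<^sub>F k in sequentially. dist (E (s k) x) (E l x) < e"
      using y e unfolding y_eq by (rule tendstoD)
    then obtain k where k: "dist (E (s k) x) (E l x) < e"
      using eventually_happens sequentially_bot by blast
    have "dist (E m x) (E l x) < e" if "m > l" "m < s k" for m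
    proof -
      have "(norm (E m x - E l x))\<^sup>2 \<le> (norm (E (s k) x - E l x))\<^sup>2"
        using norm_diff_E[of l m x] norm_diff_E[of l "s k" x] g_mono[of m "s k"] that by (simp add: g_def)
      hence "norm (E m x - E l x) \<le> norm (E (s k) x - E l x)"
        using power2_le_imp_le by (metis norm_ge_zero)
      thus ?thesis using k by (simp add: dist_norm)
    qed
    thus "\<forall>\<^sub>F m in at_right l. dist (E m x) (E l x) < e"
      using s_gt[of k] by (auto simp: eventually_at_right_field)
  qed
qed

lemma partition_norm:
  assumes "\<And>k. k < n \<Longrightarrow> p k \<le> p (Suc k)"
  shows "(\<Sum>k<n. (norm (E (p (Suc k)) x - E (p k) x))\<^sup>2) = (norm (E (p n) x))\<^sup>2 - (norm (E (p 0) x))\<^sup>2"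
  using assms sum_lessThan_telescope[of "\<lambda>k. (norm (E (p k) x))\<^sup>2" n] by (simp add: norm_diff_E)

lemma partition_orthogonal:
  assumes p: "\<And>i j. i \<le> j \<Longrightarrow> j \<le> n \<Longrightarrow> p i \<le> p j" and j: "j < n" and k: "k < n"
  shows "E (p (Suc k)) (E (p (Suc j)) x - E (p j) x) - E (p k) (E (p (Suc j)) x - E (p j) x) =
    (if j = k then E (p (Suc k)) x - E (p k) x else 0)"
proof (cases j k rule: linorder_cases)
  case less
  have "p j \<le> p k" "p j \<le> p (Suc k)" "p (Suc j) \<le> p k" "p (Suc j) \<le> p (Suc k)"
    by (intro p; use less k in simp)+
  thus ?thesis using less by (simp add: E_linear_simps E_absorb(2))
next
  case equal
  have "p k \<le> p (Suc k)" by (intro p) (use k in simp_all)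
  thus ?thesis using equal by (simp add: E_linear_simps E_absorb is_projectionD(2)[OF proj])
next
  case greater
  have "p k \<le> p j" "p k \<le> p (Suc j)" "p (Suc k) \<le> p j" "p (Suc k) \<le> p (Suc j)"
    by (intro p; use greater j in simp)+
  thus ?thesis using greater by (simp add: E_linear_simps E_absorb(1))
qed

text \<open>The increments of \<open>E\<close> are mutually orthogonal and commute with
  \<open>T\<close>, so the error is block diagonal and a bound on every block is a bound on the
  whole with the same \<open>K\<close>. It is applied with \<open>T\<close> a scalar, another
  Riemann sum, and the operator \<open>A\<close> itself.\<close>

lemma partition_estimate:
  assumes p: "\<And>i j. i \<le> j \<Longrightarrow> j \<le> n \<Longrightarrow> p i \<le> p j"
    and E0: "E (p 0) = (\<lambda>x. 0)" and E1: "E (p n) = id"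
    and T: "linear T" "\<And>l x. T (E l x) = E l (T x)"
    and K: "\<And>k. k < n \<Longrightarrow>
      (norm (T (E (p (Suc k)) x - E (p k) x) - t k *\<^sub>R (E (p (Suc k)) x - E (p k) x)))\<^sup>2
        \<le> K * (norm (E (p (Suc k)) x - E (p k) x))\<^sup>2"
  shows "(norm (T x - (\<Sum>k<n. t k *\<^sub>R (E (p (Suc k)) x - E (p k) x))))\<^sup>2 \<le> K * (norm x)\<^sup>2"
proof -
  define D where "D = (\<lambda>k x. E (p (Suc k)) x - E (p k) x)"
  define w where "w = T x - (\<Sum>k<n. t k *\<^sub>R D k x)"
  have lin: "D k (y - (\<Sum>j<n. t j *\<^sub>R z j)) = D k y - (\<Sum>j<n. t j *\<^sub>R D k (z j))" for k y and z :: "nat \<Rightarrow> 'h"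
    by (simp add: D_def E_linear_simps sum_subtractf algebra_simps)
  have Dw: "D k w = T (D k x) - t k *\<^sub>R D k x" if k: "k < n" for k
  proof -
    have "D k w = D k (T x) - (\<Sum>j<n. t j *\<^sub>R D k (D j x))"
      unfolding w_def by (rule lin)
    also have "(\<Sum>j<n. t j *\<^sub>R D k (D j x)) = (\<Sum>j<n. if j = k then t k *\<^sub>R D k x else 0)"
      using partition_orthogonal[of n p, OF p _ k] by (intro sum.cong) (auto simp: D_def)
    also have "D k (T x) = T (D k x)" by (simp add: D_def T linear_diff[OF T(1)])
    finally show ?thesis using k by simp
  qed
  have pS: "p k \<le> p (Suc k)" if "k < n" for k using p that by auto
  have norm_eq: "(norm y)\<^sup>2 = (\<Sum>k<n. (norm (D k y))\<^sup>2)" for y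
    using partition_norm[of n p y] pS by (simp add: D_def E0 E1)
  have "(norm w)\<^sup>2 \<le> (\<Sum>k<n. K * (norm (D k x))\<^sup>2)"
    unfolding norm_eq[of w] using K by (intro sum_mono) (simp add: Dw, simp add: D_def)
  also have "\<dots> = K * (norm x)\<^sup>2" by (simp add: norm_eq[of x] sum_distrib_left)
  finally show ?thesis by (simp add: w_def D_def)
qed

end

section \<open>Spectral integrals\<close>

lemma norm_sq_le_imp_le:
  "(norm x)\<^sup>2 \<le> c\<^sup>2 * (norm y)\<^sup>2 \<Longrightarrow> 0 \<le> c \<Longrightarrow> norm x \<le> c * norm y"
  unfolding power_mult_distrib[symmetric] by (erule power2_le_imp_le) simp

lemma uniform_partition_diff:
  "a + real (Suc k) * (b - a) / real N - (a + real k * (b - a) / real N) = (b - a) / real N"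
  by (simp add: distrib_right add_divide_distrib)

context projection_family
begin

text \<open>Uniform partition with left endpoints as tags; limits are taken along
  \<open>Suc N\<close> to avoid the degenerate division by \<open>0\<close>.\<close>

definition riemann_sum :: "real \<Rightarrow> real \<Rightarrow> nat \<Rightarrow> 'h \<Rightarrow> 'h" where
  "riemann_sum a b N x = (\<Sum>k<N. (a + real k * (b - a) / real N) *\<^sub>R
     (E (a + real (Suc k) * (b - a) / real N) x - E (a + real k * (b - a) / real N) x))"

lemma riemann_sum_commute:
  assumes "linear T" "\<And>l x. T (E l x) = E l (T x)"
  shows "T (riemann_sum a b N x) = riemann_sum a b N (T x)"
  unfolding riemann_sum_def
  by (simp add: linear_sum[OF assms(1)] linear_scale[OF assms(1)] linear_diff[OF assms(1)] assms(2))

lemma riemann_sum_bounded_linear: "bounded_linear (riemann_sum a b N)"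
  unfolding riemann_sum_def
  by (intro bounded_linear_sum bounded_linear_const_scaleR bounded_linear_sub E_bounded_linear)

lemma riemann_sum_scaleC: "riemann_sum a b N (c *\<^sub>C x) = c *\<^sub>C riemann_sum a b N x"
proof (rule riemann_sum_commute[symmetric])
  show "linear (\<lambda>x::'h. c *\<^sub>C x)"
    by (rule linearI) (simp_all add: scaleC_add_right scaleR_scaleC scaleC_scaleC mult.commute)
qed (simp add: clinearD[OF bops_clinear[OF E_bops]])

lemma riemann_sum_hermitian: "cinner (riemann_sum a b N x) y = cinner x (riemann_sum a b N y)"
  unfolding riemann_sum_def
  by (simp add: cinner_sum_left cinner_sum_right cinner_scaleR_left cinner_scaleR_right
      cinner_diff_left cinner_diff_right is_projectionD(3)[OF proj])

text \<open>Such an \<open>x\<close> has no component in blocks outside the interval from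
  \<open>l\<close> to \<open>m\<close>, and a block overlapping it has its tag within
  \<open>m - l\<close> plus one mesh width of \<open>t\<close>.\<close>

lemma riemann_sum_local:
  assumes ab: "a < b" "E a = (\<lambda>x. 0)" "E b = id" and N: "N > 0"
    and t: "l \<le> t" "t \<le> m" and x: "E m x = x" "E l x = 0"
  shows "norm (t *\<^sub>R x - riemann_sum a b N x) \<le> (m - l + (b - a) / real N) * norm x"
proof -
  define p where "p k = a + real k * (b - a) / real N" for k
  define h where "h = (b - a) / real N"
  have h: "h > 0" using ab N by (simp add: h_def)
  have pS: "p (Suc k) = p k + h" for k
    using uniform_partition_diff[of a k b N] by (simp add: p_def h_def)
  have "(norm (t *\<^sub>R x - (\<Sum>k<N. p k *\<^sub>R (E (p (Suc k)) x - E (p k) x))))\<^sup>2 \<le> (m - l + h)\<^sup>2 * (norm x)\<^sup>2"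
  proof (rule partition_estimate)
    show "p i \<le> p j" if "i \<le> j" for i j
      using that ab N by (auto simp: p_def intro!: divide_right_mono mult_right_mono)
    show "E (p 0) = (\<lambda>x. 0)" "E (p N) = id" using ab N by (auto simp: p_def)
    show "linear (\<lambda>x::'h. t *\<^sub>R x)" by (rule linear_scaleR)
    show "t *\<^sub>R E l x = E l (t *\<^sub>R x)" for l x by (simp add: E_linear_simps)
    fix k
    show "(norm (t *\<^sub>R (E (p (Suc k)) x - E (p k) x) - p k *\<^sub>R (E (p (Suc k)) x - E (p k) x)))\<^sup>2
        \<le> (m - l + h)\<^sup>2 * (norm (E (p (Suc k)) x - E (p k) x))\<^sup>2"
    proof (cases "p (Suc k) \<le> l \<or> m \<le> p k")
      case True
      have "E (p (Suc k)) x - E (p k) x = 0"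
        using True
      proof
        assume le: "p (Suc k) \<le> l"
        hence "E (p (Suc k)) (E l x) = E (p (Suc k)) x" "E (p k) (E l x) = E (p k) x"
          using h by (auto simp: E_absorb pS)
        thus ?thesis by (simp add: x E_linear_simps)
      next
        assume le: "m \<le> p k"
        hence "E (p (Suc k)) (E m x) = E m x" "E (p k) (E m x) = E m x"
          using h by (auto simp: E_absorb(2) pS)
        thus ?thesis by (simp add: x)
      qed
      thus ?thesis by simp
    next
      case False
      hence "\<bar>t - p k\<bar> \<le> m - l + h" using t h pS[of k] by auto
      hence "(t - p k)\<^sup>2 \<le> (m - l + h)\<^sup>2" by (rule power2_le_iff_abs_le[THEN iffD2, rotated]) (use t h in simp)
      thus ?thesis
        unfolding scaleR_diff_left[symmetric] norm_scaleR power_mult_distrib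
        by (intro mult_right_mono) simp_all
    qed
  qed
  hence "norm (t *\<^sub>R x - (\<Sum>k<N. p k *\<^sub>R (E (p (Suc k)) x - E (p k) x))) \<le> (m - l + h) * norm x"
    by (rule norm_sq_le_imp_le) (use t h in simp)
  thus ?thesis unfolding riemann_sum_def p_def h_def .
qed

text \<open>Each block of the coarse or fine \<open>N\<close>-partition is a slice on which
  \<open>riemann_sum_local\<close> compares the \<open>M\<close>-sum with a scalar;
  \<open>partition_estimate\<close> assembles the blocks.\<close>

lemma riemann_sum_estimate:
  assumes ab: "a < b" "E a = (\<lambda>x. 0)" "E b = id" and N: "N > 0" and M: "M > 0"
  shows "norm (riemann_sum a b M x - riemann_sum a b N x) \<le> ((b - a) / real N + (b - a) / real M) * norm x"
proof -
  define p where "p k = a + real k * (b - a) / real N" for k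
  define h where "h = (b - a) / real N"
  define c where "c = (b - a) / real M"
  have h: "h > 0" "c > 0" using ab N M by (simp_all add: h_def c_def)
  have pS: "p (Suc k) = p k + h" for k
    using uniform_partition_diff[of a k b N] by (simp add: p_def h_def)
  have "(norm (riemann_sum a b M x - (\<Sum>k<N. p k *\<^sub>R (E (p (Suc k)) x - E (p k) x))))\<^sup>2
      \<le> (h + c)\<^sup>2 * (norm x)\<^sup>2"
  proof (rule partition_estimate)
    show "p i \<le> p j" if "i \<le> j" for i j
      using that ab N by (auto simp: p_def intro!: divide_right_mono mult_right_mono)
    show "E (p 0) = (\<lambda>x. 0)" "E (p N) = id" using ab N by (auto simp: p_def)
    show "linear (riemann_sum a b M)" by (rule bounded_linear.linear[OF riemann_sum_bounded_linear])
    show "riemann_sum a b M (E l x) = E l (riemann_sum a b M x)" for l x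
      by (rule riemann_sum_commute[symmetric]) (auto intro: E_linear E_commute)
    fix k
    define y where "y = E (p (Suc k)) x - E (p k) x"
    have "norm (p k *\<^sub>R y - riemann_sum a b M y) \<le> (p (Suc k) - p k + c) * norm y"
      unfolding c_def using pS[of k] h
      by (intro riemann_sum_local ab M) (auto simp: y_def E_linear_simps E_absorb is_projectionD(2)[OF proj])
    hence "(norm (riemann_sum a b M y - p k *\<^sub>R y))\<^sup>2 \<le> ((h + c) * norm y)\<^sup>2"
      by (intro power_mono) (auto simp: pS norm_minus_commute)
    thus "(norm (riemann_sum a b M (E (p (Suc k)) x - E (p k) x) - p k *\<^sub>R (E (p (Suc k)) x - E (p k) x)))\<^sup>2
        \<le> (h + c)\<^sup>2 * (norm (E (p (Suc k)) x - E (p k) x))\<^sup>2"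
      by (simp add: y_def power_mult_distrib)
  qed
  hence "norm (riemann_sum a b M x - (\<Sum>k<N. p k *\<^sub>R (E (p (Suc k)) x - E (p k) x))) \<le> (h + c) * norm x"
    by (rule norm_sq_le_imp_le) (use h in simp)
  thus ?thesis unfolding riemann_sum_def[of _ _ N] p_def h_def c_def .
qed

lemma uniform_mesh_tendsto: "(\<lambda>N. (b - a) / real (Suc N)) \<longlonglongrightarrow> (0::real)"
  using LIMSEQ_Suc[OF lim_const_over_n[of "b - a"]] by simp

text \<open>The local bound is on the square of the error and only linear in \<open>m - l\<close>;
  by orthogonality of the slices, mesh \<open>d\<close> still gives a total squared error of at most
  \<open>K * d\<close> times the squared norm. \<open>spectral_theorem\<close> obtains exactly this
  weak form.\<close>

lemma spectral_family_ofI: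
  assumes rc: "\<And>l x. ((\<lambda>m. E m x) \<longlongrightarrow> E l x) (at_right l)"
    and ab: "a < b" "\<And>l. l \<le> a \<Longrightarrow> E l = (\<lambda>x. 0)" "\<And>l. l \<ge> b \<Longrightarrow> E l = id"
    and A: "linear A" "\<And>l x. A (E l x) = E l (A x)"
    and K: "K \<ge> 0" and loc: "\<And>l m t x. a \<le> l \<Longrightarrow> l \<le> t \<Longrightarrow> t \<le> m \<Longrightarrow> m \<le> b \<Longrightarrow> E m x = x \<Longrightarrow> E l x = 0 \<Longrightarrow>
      (norm (A x - t *\<^sub>R x))\<^sup>2 \<le> K * (m - l) * (norm x)\<^sup>2"
  shows "spectral_family_of A E"
proof -
  have "\<exists>\<delta>>0. \<forall>(n::nat) p t. p 0 = a \<and> p n = b \<and>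
      (\<forall>k<n. p k < p (Suc k) \<and> p (Suc k) - p k < \<delta> \<and> p k \<le> t k \<and> t k \<le> p (Suc k)) \<longrightarrow>
      onorm (\<lambda>x. A x - (\<Sum>k<n. t k *\<^sub>R (E (p (Suc k)) x - E (p k) x))) \<le> e" if e: "e > 0" for e :: real
  proof -
    \<comment> \<open>The summand \<open>1\<close> covers \<open>K = 0\<close>.\<close>
    define d where "d = e\<^sup>2 / (K + 1)"
    have d: "d > 0" using e K by (simp add: d_def)
    have Kd: "K * d \<le> e\<^sup>2" using e K by (simp add: d_def field_simps)
    show ?thesis
    proof (intro exI[of _ d] conjI d allI impI)
      fix n :: nat and p t :: "nat \<Rightarrow> real"
      assume P: "p 0 = a \<and> p n = b \<and>
        (\<forall>k<n. p k < p (Suc k) \<and> p (Suc k) - p k < d \<and> p k \<le> t k \<and> t k \<le> p (Suc k))"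
      have p: "p i \<le> p j" if "i \<le> j" "j \<le> n" for i j
        using that
      proof (induction j rule: dec_induct)
        case (step j)
        moreover have "p j < p (Suc j)" using P step by auto
        ultimately show ?case by simp
      qed simp
      show "onorm (\<lambda>x. A x - (\<Sum>k<n. t k *\<^sub>R (E (p (Suc k)) x - E (p k) x))) \<le> e"
      proof (rule onorm_bound)
        fix x
        have "(norm (A x - (\<Sum>k<n. t k *\<^sub>R (E (p (Suc k)) x - E (p k) x))))\<^sup>2 \<le> e\<^sup>2 * (norm x)\<^sup>2"
        proof (rule partition_estimate)
          show "p i \<le> p j" if "i \<le> j" "j \<le> n" for i j by (rule p[OF that])
          show "E (p 0) = (\<lambda>x. 0)" "E (p n) = id" using P ab by auto
          fix k assume k: "k < n"
          define y where "y = E (p (Suc k)) x - E (p k) x"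
          have pk: "p k \<le> p (Suc k)" using p k by simp
          have "(norm (A y - t k *\<^sub>R y))\<^sup>2 \<le> K * (p (Suc k) - p k) * (norm y)\<^sup>2"
          proof (rule loc)
            show "a \<le> p k" "p (Suc k) \<le> b" using p[of 0 k] p[of "Suc k" n] P k by auto
          qed (use P k pk in \<open>auto simp: y_def E_linear_simps E_absorb is_projectionD(2)[OF proj]\<close>)
          also have "\<dots> \<le> K * d * (norm y)\<^sup>2"
            using P k K by (intro mult_right_mono mult_left_mono) auto
          also have "\<dots> \<le> e\<^sup>2 * (norm y)\<^sup>2" by (intro mult_right_mono Kd) simp
          finally show "(norm (A (E (p (Suc k)) x - E (p k) x) - t k *\<^sub>R (E (p (Suc k)) x - E (p k) x)))\<^sup>2
            \<le> e\<^sup>2 * (norm (E (p (Suc k)) x - E (p k) x))\<^sup>2" by (simp add: y_def)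
        qed (use A in auto)
        thus "norm (A x - (\<Sum>k<n. t k *\<^sub>R (E (p (Suc k)) x - E (p k) x))) \<le> e * norm x"
          by (rule norm_sq_le_imp_le) (use e in simp)
      qed (use e in simp)
    qed
  qed
  hence "\<exists>a b. a < b \<and> (\<forall>l\<le>a. E l = (\<lambda>x. 0)) \<and> (\<forall>l\<ge>b. E l = id) \<and>
      (\<forall>\<epsilon>>0. \<exists>\<delta>>0. \<forall>(n::nat) p t. p 0 = a \<and> p n = b \<and>
        (\<forall>k<n. p k < p (Suc k) \<and> p (Suc k) - p k < \<delta> \<and> p k \<le> t k \<and> t k \<le> p (Suc k)) \<longrightarrow>
        onorm (\<lambda>x. A x - (\<Sum>k<n. t k *\<^sub>R (E (p (Suc k)) x - E (p k) x))) \<le> \<epsilon>)"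
    using ab by (intro exI[of _ a] exI[of _ b]) simp
  thus ?thesis
    unfolding spectral_family_of_def using proj mono rc by (intro conjI) simp_all
qed

lemma riemann_limit_local:
  assumes ab: "a < b" "E a = (\<lambda>x. 0)" "E b = id"
    and lim: "\<And>x. (\<lambda>N. riemann_sum a b (Suc N) x) \<longlonglongrightarrow> A x"
    and t: "l \<le> t" "t \<le> m" and x: "E m x = x" "E l x = 0"
  shows "norm (A x - t *\<^sub>R x) \<le> (m - l) * norm x"
proof -
  have "(\<lambda>N. norm (t *\<^sub>R x - riemann_sum a b (Suc N) x)) \<longlonglongrightarrow> norm (t *\<^sub>R x - A x)"
    by (intro tendsto_intros lim)
  moreover have "(\<lambda>N. (m - l + (b - a) / real (Suc N)) * norm x) \<longlonglongrightarrow> (m - l + 0) * norm x"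
    by (intro tendsto_intros uniform_mesh_tendsto)
  ultimately have "norm (t *\<^sub>R x - A x) \<le> (m - l + 0) * norm x"
    by (rule LIMSEQ_le) (intro exI[of _ 0] allI impI riemann_sum_local[OF ab _ t x] zero_less_Suc)
  thus ?thesis by (simp add: norm_minus_commute)
qed

lemma riemann_limit_commute:
  assumes lim: "\<And>x. (\<lambda>N. riemann_sum a b (Suc N) x) \<longlonglongrightarrow> A x"
    and T: "bounded_linear T" "\<And>l x. T (E l x) = E l (T x)"
  shows "T (A x) = A (T x)"
proof -
  have "(\<lambda>N. T (riemann_sum a b (Suc N) x)) \<longlonglongrightarrow> T (A x)"
    by (rule bounded_linear.tendsto[OF T(1) lim])
  thus ?thesis
    unfolding riemann_sum_commute[OF bounded_linear.linear[OF T(1)] T(2)] using lim LIMSEQ_unique by blast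
qed

text \<open>The commutation clause will place \<open>A\<close> in the algebra through its
  bicommutant.\<close>

theorem spectral_integral_exists:
  assumes rc: "\<And>l x. ((\<lambda>m. E m x) \<longlongrightarrow> E l x) (at_right l)"
    and ab: "a < b" "\<And>l. l \<le> a \<Longrightarrow> E l = (\<lambda>x. 0)" "\<And>l. l \<ge> b \<Longrightarrow> E l = id"
  obtains A where "A \<in> bops" "adj A = A" "spectral_family_of A E"
    "\<And>T x. T \<in> bops \<Longrightarrow> (\<And>l x. T (E l x) = E l (T x)) \<Longrightarrow> T (A x) = A (T x)"
proof -
  have ab': "E a = (\<lambda>x. 0)" "E b = id" using ab by auto
  note est = riemann_sum_estimate[OF ab(1) ab']
  have "\<exists>y. (\<lambda>N. riemann_sum a b (Suc N) x) \<longlonglongrightarrow> y" for x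
  proof -
    have "Cauchy (\<lambda>N. riemann_sum a b (Suc N) x)"
    proof (rule CauchyI)
      fix e :: real assume e: "e > 0"
      have "(\<lambda>N. (b - a) / real (Suc N) * norm x) \<longlonglongrightarrow> 0 * norm x"
        by (intro tendsto_intros uniform_mesh_tendsto)
      hence "\<forall>\<^sub>F N in sequentially. (b - a) / real (Suc N) * norm x < e / 2"
        using e by (intro order_tendstoD(2)) auto
      then obtain N0 where N0: "\<And>N. N \<ge> N0 \<Longrightarrow> (b - a) / real (Suc N) * norm x < e / 2"
        by (auto simp: eventually_sequentially)
      have "norm (riemann_sum a b (Suc m) x - riemann_sum a b (Suc n) x) < e" if "m \<ge> N0" "n \<ge> N0" for m n
        using est[of "Suc n" "Suc m" x] N0[OF that(1)] N0[OF that(2)]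
        unfolding distrib_right by linarith
      thus "\<exists>N0. \<forall>m\<ge>N0. \<forall>n\<ge>N0. norm (riemann_sum a b (Suc m) x - riemann_sum a b (Suc n) x) < e" by blast
    qed
    thus ?thesis using Cauchy_convergent_iff convergent_def by blast
  qed
  then obtain A where lim: "\<And>x. (\<lambda>N. riemann_sum a b (Suc N) x) \<longlonglongrightarrow> A x" by metis
  note rlin = bounded_linear.linear[OF riemann_sum_bounded_linear]
  have add: "A (x + y) = A x + A y" for x y
    using tendsto_add[OF lim[of x] lim[of y]] LIMSEQ_unique[OF lim[of "x + y"]]
    by (simp add: linear_add[OF rlin])
  have "(\<lambda>N. c *\<^sub>C riemann_sum a b (Suc N) x) \<longlonglongrightarrow> c *\<^sub>C A x" for c x
    by (rule bounded_linear.tendsto[OF _ lim], rule bounded_linear_intro[of _ "cmod c"])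
       (simp_all add: scaleC_add_right scaleR_scaleC scaleC_scaleC mult.commute norm_scaleC)
  hence scale: "A (c *\<^sub>C x) = c *\<^sub>C A x" for c x
    using LIMSEQ_unique[OF lim[of "c *\<^sub>C x"]] by (simp add: riemann_sum_scaleC)
  have clin: "clinear A" by (simp add: clinear_def add scale)
  have loc: "norm (A x - t *\<^sub>R x) \<le> (m - l) * norm x"
    if "l \<le> t" "t \<le> m" "E m x = x" "E l x = 0" for l m t x
    using riemann_limit_local[OF ab(1) ab' lim that] .
  have "norm (A x) \<le> norm x * (b - a + \<bar>a\<bar>)" for x
  proof -
    have "norm (A x - a *\<^sub>R x) \<le> (b - a) * norm x"
      by (rule loc) (use ab ab' in auto)
    thus ?thesis using norm_triangle_ineq[of "A x - a *\<^sub>R x" "a *\<^sub>R x"] by (simp add: algebra_simps)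
  qed
  with clin have Ab: "A \<in> bops" by (auto simp: bops_def)
  have comm: "T (A x) = A (T x)" if "T \<in> bops" "\<And>l x. T (E l x) = E l (T x)" for T x
    using riemann_limit_commute[OF lim bops_bounded_linear] that by blast
  have "adj A = A"
  proof (rule adj_eqI)
    show "cinner (A x) y = cinner x (A y)" for x y
      using tendsto_cinner_left[OF lim[of x], of y] tendsto_cinner_right[OF lim[of y], of x]
      unfolding riemann_sum_hermitian by (rule LIMSEQ_unique)
  qed
  moreover have "spectral_family_of A E"
  proof (rule spectral_family_ofI[OF rc ab bops_linear[OF Ab]])
    show "A (E l x) = E l (A x)" for l x by (rule comm[symmetric]) (auto intro: E_bops E_commute)
    fix l m t x assume *: "a \<le> l" "l \<le> t" "t \<le> m" "m \<le> b" "E m x = x" "E l x = 0"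
    have "(norm (A x - t *\<^sub>R x))\<^sup>2 \<le> ((m - l) * norm x)\<^sup>2"
      by (intro power_mono loc *) simp
    also have "\<dots> = (m - l) * (m - l) * (norm x)\<^sup>2" by (simp add: power2_eq_square)
    \<comment> \<open>The available bound is quadratic in the width; one factor is given up for
      \<open>b - a\<close> to reach the linear form.\<close>
    also have "\<dots> \<le> (b - a) * (m - l) * (norm x)\<^sup>2" using * by (intro mult_right_mono) auto
    finally show "(norm (A x - t *\<^sub>R x))\<^sup>2 \<le> (b - a) * (m - l) * (norm x)\<^sup>2" .
  qed (use ab in auto)
  ultimately show ?thesis using that Ab comm by blast
qed

end

subsection \<open>Uniqueness of the spectral family\<close>

lemma spectral_family_of_projection: "spectral_family_of A E \<Longrightarrow> is_projection (E l)"
  by (simp add: spectral_family_of_def)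

text \<open>From norm convergence over all tagged partitions only the pointwise limit along uniform
  ones is kept: it suffices for commutation and for the local estimates behind uniqueness.\<close>

lemma spectral_family_ofE:
  assumes A: "A \<in> bops" and sf: "spectral_family_of A E"
  obtains a b where "projection_family E" "a < b" "\<And>l. l \<le> a \<Longrightarrow> E l = (\<lambda>x. 0)" "\<And>l. l \<ge> b \<Longrightarrow> E l = id"
    "\<And>x. (\<lambda>N. projection_family.riemann_sum E a b (Suc N) x) \<longlonglongrightarrow> A x"
proof -
  interpret projection_family E
    using sf[unfolded spectral_family_of_def, THEN conjunct1]
      sf[unfolded spectral_family_of_def, THEN conjunct2, THEN conjunct1]
    by unfold_locales auto
  from sf[unfolded spectral_family_of_def, THEN conjunct2, THEN conjunct2, THEN conjunct2]
  obtain a b where H: "a < b \<and> (\<forall>l\<le>a. E l = (\<lambda>x. 0)) \<and> (\<forall>l\<ge>b. E l = id) \<and>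
      (\<forall>\<epsilon>>0. \<exists>\<delta>>0. \<forall>(n::nat) (p::nat \<Rightarrow> real) (t::nat \<Rightarrow> real). p 0 = a \<and> p n = b \<and>
        (\<forall>k<n. p k < p (Suc k) \<and> p (Suc k) - p k < \<delta> \<and> p k \<le> t k \<and> t k \<le> p (Suc k)) \<longrightarrow>
        onorm (\<lambda>x. A x - (\<Sum>k<n. t k *\<^sub>R (E (p (Suc k)) x - E (p k) x))) \<le> \<epsilon>)"
    by (elim exE) (rule that)
  from H have ab: "a < b" "\<And>l. l \<le> a \<Longrightarrow> E l = (\<lambda>x. 0)" "\<And>l. l \<ge> b \<Longrightarrow> E l = id"
    by simp_all
  note rs = H[THEN conjunct2, THEN conjunct2, THEN conjunct2, rule_format]
  have "(\<lambda>N. riemann_sum a b (Suc N) x) \<longlonglongrightarrow> A x" for x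
  proof (rule LIMSEQ_I)
    fix r :: real assume r: "r > 0"
    define e where "e = r / (norm x + 1)"
    have nx: "norm x + 1 > 0" using norm_ge_zero[of x] by linarith
    have e: "e > 0" "e * norm x < r" using r nx by (simp_all add: e_def field_simps)
    from rs[OF e(1)] obtain d where d: "d > 0" and rs': "\<And>(n::nat) p t. p 0 = a \<and> p n = b \<and>
      (\<forall>k<n. p k < p (Suc k) \<and> p (Suc k) - p k < d \<and> p k \<le> t k \<and> t k \<le> p (Suc k)) \<Longrightarrow>
      onorm (\<lambda>x. A x - (\<Sum>k<n. t k *\<^sub>R (E (p (Suc k)) x - E (p k) x))) \<le> e"
      by blast
    have "\<forall>\<^sub>F N in sequentially. (b - a) / real (Suc N) < d"
      by (rule order_tendstoD(2)[OF uniform_mesh_tendsto d])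
    then obtain N0 where N0: "\<And>N. N \<ge> N0 \<Longrightarrow> (b - a) / real (Suc N) < d"
      by (auto simp: eventually_sequentially)
    have "norm (riemann_sum a b (Suc N) x - A x) < r" if "N \<ge> N0" for N
    proof -
      define p where "p k = a + real k * (b - a) / real (Suc N)" for k
      have "p (Suc k) - p k = (b - a) / real (Suc N)" for k
        unfolding p_def by (rule uniform_partition_diff)
      moreover have "(b - a) / real (Suc N) > 0" using ab(1) by simp
      ultimately have "\<forall>k<Suc N. p k < p (Suc k) \<and> p (Suc k) - p k < d \<and> p k \<le> p k \<and> p k \<le> p (Suc k)"
        using N0[OF that] by (metis diff_gt_0_iff_gt less_imp_le order_refl)
      moreover have "p 0 = a" "p (Suc N) = b" by (simp_all add: p_def)
      ultimately have "onorm (\<lambda>x. A x - (\<Sum>k<Suc N. p k *\<^sub>R (E (p (Suc k)) x - E (p k) x))) \<le> e"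
        by (intro rs') blast
      hence on: "onorm (\<lambda>x. A x - riemann_sum a b (Suc N) x) \<le> e"
        unfolding riemann_sum_def p_def .
      have "norm (A x - riemann_sum a b (Suc N) x) \<le> onorm (\<lambda>x. A x - riemann_sum a b (Suc N) x) * norm x"
        by (intro onorm bounded_linear_sub bops_bounded_linear[OF A] riemann_sum_bounded_linear)
      also have "\<dots> \<le> e * norm x" by (intro mult_right_mono on) simp
      finally show ?thesis using e(2) by (simp add: norm_minus_commute)
    qed
    thus "\<exists>N0. \<forall>N\<ge>N0. norm (riemann_sum a b (Suc N) x - A x) < r" by blast
  qed
  with that ab show ?thesis using projection_family_axioms by blast
qed

lemma spectral_family_of_commute:
  assumes A: "A \<in> bops" and sf: "spectral_family_of A E"
    and T: "T \<in> bops" "\<And>l x. T (E l x) = E l (T x)"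
  shows "T (A x) = A (T x)"
proof -
  obtain a b where pf: "projection_family E" and
    lim: "\<And>x. (\<lambda>N. projection_family.riemann_sum E a b (Suc N) x) \<longlonglongrightarrow> A x"
    using spectral_family_ofE[OF A sf] by metis
  show ?thesis
    using projection_family.riemann_limit_commute[OF pf lim bops_bounded_linear[OF T(1)] T(2)] .
qed

lemma spectral_family_of_commute_E:
  assumes A: "A \<in> bops" and sf: "spectral_family_of A E"
  shows "E l (A x) = A (E l x)"
proof -
  obtain a b where pf: "projection_family E"
    using spectral_family_ofE[OF A sf] by metis
  interpret projection_family E by fact
  show ?thesis by (rule spectral_family_of_commute[OF A sf]) (auto intro: E_bops E_commute)
qed

lemma geometric_growth_imp_zero:
  fixes q r X Z :: real
  assumes le: "\<And>n::nat. r ^ n * Z \<le> q ^ n * X" and "0 \<le> q" "q < r" "0 \<le> Z"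
  shows "Z = 0"
proof -
  have r: "r > 0" using assms by simp
  have "(\<lambda>n. (q / r) ^ n * X) \<longlonglongrightarrow> 0 * X"
    using assms r by (intro tendsto_intros LIMSEQ_realpow_zero) auto
  moreover have "Z \<le> (q / r) ^ n * X" for n
    using le[of n] r by (simp add: power_divide field_simps)
  ultimately have "Z \<le> 0" using LIMSEQ_le_const by fastforce
  with assms show ?thesis by simp
qed

text \<open>Both spectral families see the same growth rate of \<open>(A + c)\<^sup>n x\<close>, at most \<open>(l + c)\<^sup>n\<close> on the range of \<open>E l\<close>
  and at least \<open>(m + c)\<^sup>n\<close> on the kernel of \<open>F m\<close>.\<close>

lemma spectral_family_of_range_le:
  assumes A: "A \<in> bops" and E: "spectral_family_of A E" and F: "spectral_family_of A F"
    and x: "E l x = x"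
  shows "F l x = x"
proof -
  obtain a b where pE: "projection_family E" and ab: "a < b"
    and Ea: "\<And>l. l \<le> a \<Longrightarrow> E l = (\<lambda>x. 0)" and Eb: "\<And>l. l \<ge> b \<Longrightarrow> E l = id"
    and limE: "\<And>x. (\<lambda>N. projection_family.riemann_sum E a b (Suc N) x) \<longlonglongrightarrow> A x"
    using spectral_family_ofE[OF A E] by metis
  obtain a' b' where pF: "projection_family F" and ab': "a' < b'"
    and Fa: "\<And>l. l \<le> a' \<Longrightarrow> F l = (\<lambda>x. 0)" and Fb: "\<And>l. l \<ge> b' \<Longrightarrow> F l = id"
    and limF: "\<And>x. (\<lambda>N. projection_family.riemann_sum F a' b' (Suc N) x) \<longlonglongrightarrow> A x"
    using spectral_family_ofE[OF A F] by metis
  interpret E: projection_family E by fact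
  interpret F: projection_family F by fact
  show ?thesis
  proof (cases "l \<le> a")
    case True
    hence "x = 0" using Ea x by metis
    thus ?thesis by (simp add: F.E_linear_simps)
  next
    case False
    \<comment> \<open>One shift serves both families: it makes the lower endpoints
      \<open>a + c\<close> and \<open>a' + c\<close> nonnegative, so \<open>B\<close> behaves as a
      positive operator for each.\<close>
    define c where "c = max (- a) (- a')"
    have c: "a + c \<ge> 0" "a' + c \<ge> 0" by (auto simp: c_def)
    define B where "B y = A y + c *\<^sub>R y" for y
    have upper: "norm (B y) \<le> (l + c) * norm y" if y: "E l y = y" for y
    proof -
      have "norm (A y - a *\<^sub>R y) \<le> (l - a) * norm y"
        using E.riemann_limit_local[OF ab Ea[OF order_refl] Eb[OF order_refl] limE, of a a l y] False y Ea[of a]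
        by simp
      moreover have "B y = (A y - a *\<^sub>R y) + (a + c) *\<^sub>R y" by (simp add: B_def algebra_simps)
      hence "norm (B y) \<le> norm (A y - a *\<^sub>R y) + (a + c) * norm y"
        using norm_triangle_ineq[of "A y - a *\<^sub>R y" "(a + c) *\<^sub>R y"] c(1)
        by (simp only: norm_scaleR abs_of_nonneg)
      ultimately show ?thesis by (simp add: algebra_simps)
    qed
    have E_iter: "E l ((B ^^ n) x) = (B ^^ n) x" for n
      by (induction n) (simp_all add: x B_def E.E_linear_simps spectral_family_of_commute_E[OF A E])
    have up_n: "norm ((B ^^ n) x) \<le> (l + c) ^ n * norm x" for n
    proof (induction n)
      case (Suc n)
      have "norm ((B ^^ Suc n) x) \<le> (l + c) * norm ((B ^^ n) x)" using upper[OF E_iter] by simp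
      also have "\<dots> \<le> (l + c) * ((l + c) ^ n * norm x)" using False c Suc.IH by (intro mult_left_mono) auto
      finally show ?case by simp
    qed simp
    have "F m x = x" if m: "m > l" for m
    proof -
      define z where "z = x - F m x"
      have lower: "(m + c) * norm y \<le> norm (B y)" if y: "F m y = 0" for y
      proof (cases "m \<le> b'")
        case True
        have "norm (A y - b' *\<^sub>R y) \<le> (b' - m) * norm y"
          using F.riemann_limit_local[OF ab' Fa[OF order_refl] Fb[OF order_refl] limF, of m b' b' y] True y Fb[of b']
          by simp
        moreover have "(b' + c) *\<^sub>R y = B y - (A y - b' *\<^sub>R y)" by (simp add: B_def algebra_simps)
        hence "norm ((b' + c) *\<^sub>R y) \<le> norm (B y) + norm (A y - b' *\<^sub>R y)"
          using norm_triangle_ineq4[of "B y" "A y - b' *\<^sub>R y"] by (simp only:)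
        hence "(b' + c) * norm y \<le> norm (B y) + norm (A y - b' *\<^sub>R y)"
          using c(2) ab' by simp
        ultimately show ?thesis by (simp add: algebra_simps)
      next
        case False
        hence "y = 0" using y Fb[of m] by simp
        thus ?thesis by simp
      qed
      have Bz: "(B ^^ n) z = (B ^^ n) x - F m ((B ^^ n) x)" for n
      proof (induction n)
        case (Suc n)
        have "B (u - F m u) = B u - F m (B u)" for u
          by (simp add: B_def F.E_linear_simps spectral_family_of_commute_E[OF A F]
            linear_diff[OF bops_linear[OF A]] algebra_simps)
        with Suc.IH show ?case by simp
      qed (simp add: z_def)
      have Fz: "F m ((B ^^ n) z) = 0" for n
        by (simp add: Bz F.E_linear_simps is_projectionD(2)[OF F.proj])
      have mc: "m + c \<ge> 0" using m False c by simp
      have low_n: "(m + c) ^ n * norm z \<le> norm ((B ^^ n) z)" for n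
      proof (induction n)
        case (Suc n)
        have "(m + c) ^ Suc n * norm z \<le> (m + c) * norm ((B ^^ n) z)"
          using mult_left_mono[OF Suc.IH mc] by (simp add: mult.assoc)
        also have "\<dots> \<le> norm ((B ^^ Suc n) z)" using lower[OF Fz] by simp
        finally show ?case .
      qed simp
      have "norm ((B ^^ n) z) \<le> norm ((B ^^ n) x)" for n
        unfolding Bz using norm_projection_le[OF is_projection_compl[OF F.proj]] .
      hence "(m + c) ^ n * norm z \<le> (l + c) ^ n * norm x" for n
        using low_n up_n order_trans by meson
      hence "norm z = 0"
        by (rule geometric_growth_imp_zero) (use False c m in auto)
      thus ?thesis by (simp add: z_def)
    qed
    \<comment> \<open>The growth comparison needs a strict gap \<open>m > l\<close>; right
      continuity of \<open>F\<close> carries the result down to \<open>l\<close>.\<close>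
    hence "\<forall>\<^sub>F m in at_right l. F m x = x"
      by (auto simp: eventually_at_right_field intro: exI[of _ "l + 1"])
    moreover have "((\<lambda>m. F m x) \<longlongrightarrow> F l x) (at_right l)"
      using F by (simp add: spectral_family_of_def)
    ultimately have "((\<lambda>m. x) \<longlongrightarrow> F l x) (at_right l)"
      by (rule Lim_transform_eventually[rotated])
    thus ?thesis using tendsto_unique[OF trivial_limit_at_right_real] tendsto_const by metis
  qed
qed

theorem spectral_family_unique:
  assumes A: "A \<in> bops" and E: "spectral_family_of A E"
  shows "spectral_family A = E"
  unfolding spectral_family_def
proof (rule the_equality[where P = "spectral_family_of A", OF E])
  fix F assume F: "spectral_family_of A F"
  have pr: "is_projection (E l)" "is_projection (F l)" for l
    by (intro spectral_family_of_projection[OF E] spectral_family_of_projection[OF F])+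
  show "F = E"
    using spectral_family_of_range_le[OF A E F] spectral_family_of_range_le[OF A F E]
    by (intro ext[of F E] proj_le_antisym pr) (simp_all add: proj_le_fixes pr)
qed

section \<open>The spectral theorem\<close>

lemma bounded_linear_funpow:
  assumes "bounded_linear (B :: 'a::real_normed_vector \<Rightarrow> 'a)"
  shows "bounded_linear (B ^^ n)"
proof (induction n)
  case 0
  show ?case using bounded_linear_ident by (simp add: id_def)
next
  case (Suc n)
  thus ?case using bounded_linear_compose[OF assms Suc] by (simp add: o_def)
qed

section \<open>Growth subspaces of a hermitian operator\<close>

locale hermitian =
  fixes B :: "'h::chilbert_space \<Rightarrow> 'h"
  assumes B_bops: "B \<in> bops" and herm: "cinner (B x) y = cinner x (B y)"
begin

lemma funpow_bounded_linear: "bounded_linear (B ^^ n)"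
  by (rule bounded_linear_funpow[OF bops_bounded_linear[OF B_bops]])

lemmas funpow_linear = bounded_linear.linear[OF funpow_bounded_linear]

lemma funpow_scaleC: "(B ^^ n) (c *\<^sub>C x) = c *\<^sub>C (B ^^ n) x"
  by (induction n) (simp_all add: clinearD[OF bops_clinear[OF B_bops]])

lemma funpow_herm: "cinner ((B ^^ n) x) y = cinner x ((B ^^ n) y)"
proof (induction n arbitrary: y)
  case (Suc n)
  have "cinner ((B ^^ Suc n) x) y = cinner x ((B ^^ n) (B y))"
    using Suc.IH[of "B y"] herm[of "(B ^^ n) x" y] by simp
  thus ?case by (simp add: funpow_swap1)
qed simp

definition growth :: "real \<Rightarrow> 'h set" where
  "growth r = {x. \<forall>n. norm ((B ^^ n) x) \<le> r ^ n * norm x}"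

text \<open>Hermiticity and Cauchy-Schwarz make the ratios of consecutive
  \<open>norm ((B ^^ n) x)\<close> nondecreasing. A first ratio \<open>q > r\<close> would therefore
  force growth like \<open>q ^ n\<close>, which no multiple of \<open>r ^ n\<close>
  dominates.\<close>

lemma growth_step:
  assumes r: "0 \<le> r" and C: "\<And>n. norm ((B ^^ n) x) \<le> C * r ^ n"
  shows "norm (B x) \<le> r * norm x"
proof (rule ccontr)
  assume "\<not> norm (B x) \<le> r * norm x"
  hence gt: "norm (B x) > r * norm x" by simp
  have x0: "norm x > 0"
  proof (rule ccontr)
    assume "\<not> norm x > 0"
    hence "x = 0" by simp
    thus False using gt linear_0[OF bops_linear[OF B_bops]] by simp
  qed
  define q where "q = norm (B x) / norm x"
  have q: "q > r" using gt x0 by (simp add: q_def field_simps)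
  hence q0: "q > 0" using r by simp
  define b where "b n = norm ((B ^^ n) x)" for n
  have b0: "b 0 > 0" "b 1 = q * b 0" using x0 by (simp_all add: b_def q_def)
  have convex: "(b (Suc n))\<^sup>2 \<le> b n * b (Suc (Suc n))" for n
  proof -
    have "(b (Suc n))\<^sup>2 = Re (cinner ((B ^^ n) x) ((B ^^ Suc (Suc n)) x))"
      unfolding b_def by (simp add: Re_cinner_self[symmetric] herm)
    also have "\<dots> \<le> b n * b (Suc (Suc n))" unfolding b_def by (rule Re_cinner_le)
    finally show ?thesis .
  qed
  have ratio: "b n > 0 \<and> b (Suc n) \<ge> q * b n" for n
  proof (induction n)
    case 0 thus ?case using b0 by simp
  next
    case (Suc n)
    hence pos: "b n > 0" "b (Suc n) > 0" using q0 by (auto intro: less_le_trans[OF mult_pos_pos])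
    have "q * b n * b (Suc n) \<le> (b (Suc n))\<^sup>2"
      unfolding power2_eq_square using Suc pos by (intro mult_right_mono) auto
    also note convex[of n]
    finally have "b n * (q * b (Suc n)) \<le> b n * b (Suc (Suc n))" by (simp add: mult_ac)
    thus ?case using pos by simp
  qed
  have "q ^ n * b 0 \<le> b n" for n
  proof (induction n)
    case (Suc n)
    have "q ^ Suc n * b 0 \<le> q * b n" using Suc q0 by (simp add: mult.assoc)
    also have "\<dots> \<le> b (Suc n)" using ratio by simp
    finally show ?case .
  qed simp
  hence "q ^ n * b 0 \<le> r ^ n * C" for n
    using C[of n] unfolding b_def by (metis mult.commute order_trans)
  hence "b 0 = 0" by (rule geometric_growth_imp_zero) (use q r b0 in auto)
  thus False using b0 by simp
qed

text \<open>The sequence \<open>\<parallel>B\<^sup>n x\<parallel>\<close> is log-convex, so the exponential bound holds with the constant \<open>\<parallel>x\<parallel>\<close>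
  once it holds with any constant: this makes \<open>growth r\<close> both closed and a subspace.\<close>

lemma growth_iff:
  assumes r: "0 \<le> r"
  shows "x \<in> growth r \<longleftrightarrow> (\<exists>C. \<forall>n. norm ((B ^^ n) x) \<le> C * r ^ n)"
proof
  assume "x \<in> growth r"
  thus "\<exists>C. \<forall>n. norm ((B ^^ n) x) \<le> C * r ^ n"
    by (intro exI[of _ "norm x"]) (simp add: growth_def mult.commute)
next
  assume "\<exists>C. \<forall>n. norm ((B ^^ n) x) \<le> C * r ^ n"
  then obtain C where C: "\<And>n. norm ((B ^^ n) x) \<le> C * r ^ n" by blast
  have step: "norm ((B ^^ Suc n) x) \<le> r * norm ((B ^^ n) x)" for n
  proof -
    have "norm ((B ^^ k) ((B ^^ n) x)) \<le> (C * r ^ n) * r ^ k" for k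
      using C[of "k + n"] by (simp add: funpow_add power_add mult_ac)
    from growth_step[OF r this] show ?thesis by simp
  qed
  have "norm ((B ^^ n) x) \<le> r ^ n * norm x" for n
  proof (induction n)
    case (Suc n)
    have "r * norm ((B ^^ n) x) \<le> r * (r ^ n * norm x)" by (intro mult_left_mono Suc r)
    with step[of n] show ?case by simp
  qed simp
  thus "x \<in> growth r" by (simp add: growth_def)
qed

text \<open>Applying \<open>T\<close> costs its operator bound \<open>K\<close> in the constant, and
  \<open>growth_iff\<close> admits any constant.\<close>

lemma growth_invariant:
  assumes r: "0 \<le> r" and T: "T \<in> bops" "\<And>x. T (B x) = B (T x)" and x: "x \<in> growth r"
  shows "T x \<in> growth r"
proof -
  obtain K where K: "\<And>x. norm (T x) \<le> norm x * K" "K > 0"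
    using bounded_linear.pos_bounded[OF bops_bounded_linear[OF T(1)]] by blast
  have comm: "(B ^^ n) (T x) = T ((B ^^ n) x)" for n
    by (induction n) (simp_all add: T(2))
  have "norm ((B ^^ n) (T x)) \<le> (norm x * K) * r ^ n" for n
  proof -
    have "norm ((B ^^ n) (T x)) \<le> norm ((B ^^ n) x) * K" unfolding comm by (rule K)
    also have "\<dots> \<le> (r ^ n * norm x) * K"
      using x K(2) by (intro mult_right_mono) (auto simp: growth_def)
    finally show ?thesis by (simp add: mult_ac)
  qed
  thus ?thesis using growth_iff[OF r] by blast
qed

lemma closed_csubspace_growth:
  assumes r: "0 \<le> r"
  shows "closed_csubspace (growth r)"
  unfolding closed_csubspace_def
proof (intro conjI ballI allI)
  have "continuous_on UNIV (B ^^ n)" for n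
    by (rule linear_continuous_on[OF funpow_bounded_linear])
  thus "closed (growth r)"
    unfolding growth_def by (intro closed_Collect_all closed_Collect_le continuous_intros)
  show "0 \<in> growth r" using linear_0[OF funpow_linear] by (simp add: growth_def)
  fix x assume x: "x \<in> growth r"
  show "x + y \<in> growth r" if y: "y \<in> growth r" for y
  proof -
    from x y obtain C D where CD: "\<And>n. norm ((B ^^ n) x) \<le> C * r ^ n" "\<And>n. norm ((B ^^ n) y) \<le> D * r ^ n"
      unfolding growth_iff[OF r] by blast
    have "norm ((B ^^ n) (x + y)) \<le> (C + D) * r ^ n" for n
      using CD(1)[of n] CD(2)[of n] norm_triangle_ineq[of "(B ^^ n) x" "(B ^^ n) y"]
      by (simp add: linear_add[OF funpow_linear] distrib_right)
    thus ?thesis unfolding growth_iff[OF r] by blast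
  qed
  show "c *\<^sub>C x \<in> growth r" for c
    using x mult_left_mono[of _ _ "cmod c"] by (auto simp: growth_def funpow_scaleC norm_scaleC mult.left_commute)
qed

lemma growth_mono:
  assumes "0 \<le> r" "r \<le> s"
  shows "growth r \<subseteq> growth s"
proof
  fix x assume x: "x \<in> growth r"
  have "norm ((B ^^ n) x) \<le> s ^ n * norm x" for n
  proof -
    have "norm ((B ^^ n) x) \<le> r ^ n * norm x" using x by (simp add: growth_def)
    also have "\<dots> \<le> s ^ n * norm x" by (intro mult_right_mono power_mono assms) simp
    finally show ?thesis .
  qed
  thus "x \<in> growth s" by (simp add: growth_def)
qed

end

section \<open>Positive operators: the form bound orthogonal to a growth subspace\<close>

locale positive_hermitian = hermitian B for B :: "'h::chilbert_space \<Rightarrow> 'h" +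
  assumes pos: "0 \<le> Re (cinner (B x) x)"
begin

text \<open>Even powers are squares of hermitian operators; odd powers are \<open>B\<close>
  sandwiched between two equal powers.\<close>

lemma funpow_pos: "0 \<le> Re (cinner ((B ^^ n) x) x)"
proof (cases "even n")
  case True
  then obtain k where "n = k + k" by (metis dvd_def mult_2)
  hence "cinner ((B ^^ n) x) x = cinner ((B ^^ k) x) ((B ^^ k) x)"
    using funpow_herm[of k "(B ^^ k) x" x] by (simp add: funpow_add)
  thus ?thesis by (simp add: Re_cinner_self)
next
  case False
  then obtain k where k: "n = k + Suc k" by (metis add_Suc_right mult_2 oddE Suc_eq_plus1)
  have "cinner ((B ^^ n) x) x = cinner ((B ^^ Suc k) x) ((B ^^ k) x)"
    unfolding k funpow_add using funpow_herm[of k "(B ^^ Suc k) x" x] by (simp del: funpow.simps)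
  thus ?thesis using pos[of "(B ^^ k) x"] by simp
qed

lemma funpow_pos2: "0 \<le> Re (cinner ((B ^^ m) x) ((B ^^ n) x))"
  using funpow_pos[of "n + m" x] funpow_herm[of n "(B ^^ m) x" x] by (simp add: funpow_add)

text \<open>Partial Neumann series of the inverse of \<open>1 - B\<close>. For a number
  \<open>s \<ge> 0\<close> in place of \<open>B\<close>, the reciprocals of these sums decrease to
  \<open>1 - s\<close> if \<open>s < 1\<close> and to \<open>0\<close> otherwise, that is, to the
  positive part of \<open>1 - s\<close>.\<close>

definition geom :: "nat \<Rightarrow> 'h \<Rightarrow> 'h" where
  "geom n x = (\<Sum>k\<le>n. (B ^^ k) x)"

lemma geom_bounded_linear: "bounded_linear (geom n)"
  unfolding geom_def by (intro bounded_linear_sum funpow_bounded_linear)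

lemmas geom_diff = linear_diff[OF bounded_linear.linear[OF geom_bounded_linear]]

lemma geom_herm: "cinner (geom n x) y = cinner x (geom n y)"
  by (simp add: geom_def cinner_sum_left cinner_sum_right funpow_herm)

lemma geom_ge_term: "k \<le> n \<Longrightarrow> Re (cinner ((B ^^ k) x) x) \<le> Re (cinner (geom n x) x)"
  unfolding geom_def cinner_sum_left Re_sum
  by (rule member_le_sum[of k "{..n}"]) (auto intro: funpow_pos)

lemma geom_ge: "(norm x)\<^sup>2 \<le> Re (cinner (geom n x) x)"
  using geom_ge_term[of 0 n x] by (simp add: Re_cinner_self)

lemma norm_geom_ge: "norm x \<le> norm (geom n x)"
proof (cases "x = 0")
  case False
  have "norm x * norm x \<le> norm (geom n x) * norm x"
    using geom_ge[of x n] Re_cinner_le[of "geom n x" x] by (simp add: power2_eq_square)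
  thus ?thesis using False by simp
qed simp

text \<open>\<open>geom n\<close> is at least the identity as a form. Hence it is bounded below, so
  its range is closed, and a vector orthogonal to the range pairs to zero with its own image and
  must vanish.\<close>

lemma geom_surj: "\<exists>y. geom n y = x"
proof -
  have "complete (range (geom n))"
    by (rule complete_isometric_image[of 1])
      (auto simp: geom_bounded_linear norm_geom_ge complete_UNIV)
  hence "closed (range (geom n))" by (rule complete_imp_closed)
  moreover have "c *\<^sub>C geom n y = geom n (c *\<^sub>C y)" for c y
  proof -
    have "linear (\<lambda>z::'h. c *\<^sub>C z)"
      by (rule linearI) (simp_all add: scaleC_add_right scaleR_scaleC scaleC_scaleC mult.commute)
    thus ?thesis by (simp add: geom_def funpow_scaleC linear_sum)
  qed
  ultimately have M: "closed_csubspace (range (geom n))"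
    unfolding closed_csubspace_def
    using linear_0[OF bounded_linear.linear[OF geom_bounded_linear[of n]]]
      linear_add[OF bounded_linear.linear[OF geom_bounded_linear[of n]]]
    by (auto simp: image_iff) metis+
  define w where "w = x - orth_proj (range (geom n)) x"
  have "cinner (geom n w) w = 0"
    unfolding w_def by (rule orth_proj_orth[OF M]) simp
  hence "w = 0" using geom_ge[of w n] by simp
  hence "x = orth_proj (range (geom n)) x" by (simp add: w_def)
  thus ?thesis using orth_proj_in[OF M, of x] by auto
qed

text \<open>With \<open>geom n y\<^sub>n = x\<close>, the \<open>y\<^sub>n\<close> converge to \<open>(1 - B)\<^sup>+ x\<close>, which lies in \<open>growth 1\<close>.\<close>

lemma lower_bound_one:
  assumes orth: "\<And>z. z \<in> growth 1 \<Longrightarrow> cinner z x = 0"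
  shows "(norm x)\<^sup>2 \<le> Re (cinner (B x) x)"
proof -
  obtain y where y: "\<And>n. geom n (y n) = x"
    using choice[of "\<lambda>n y. geom n y = x"] geom_surj by blast
  define g where "g n = Re (cinner x (y n))" for n
  have g_geom: "g n = Re (cinner (geom n (y n)) (y n))" for n by (simp add: g_def y)
  have g_ge: "(norm (y n))\<^sup>2 \<le> g n" for n unfolding g_geom by (rule geom_ge)
  have y_le: "norm (y n) \<le> norm x" for n using norm_geom_ge[of "y n" n] by (simp add: y)
  have g_le: "g n \<le> (norm x)\<^sup>2" for n
    using Re_cinner_le[of x "y n"] mult_left_mono[OF y_le[of n], of "norm x"]
    by (simp add: g_def power2_eq_square)
  \<comment> \<open>\<open>geom m - geom n\<close> is a sum of positive powers, so \<open>g\<close>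
    decreases and its gaps dominate the squared distances; convergence of \<open>g\<close> then
    makes \<open>y\<close> Cauchy.\<close>
  have dist_le: "(norm (y n - y m))\<^sup>2 \<le> g n - g m" if nm: "n \<le> m" for n m
  proof -
    define d where "d = y n - y m"
    define t where "t = geom m (y m) - geom n (y m)"
    have t_sum: "t = (\<Sum>k\<in>{n<..m}. (B ^^ k) (y m))"
      using nm sum.subset_diff[of "{..n}" "{..m}" "\<lambda>k. (B ^^ k) (y m)"]
      by (simp add: t_def geom_def) (rule sum.cong, auto)
    have "0 \<le> Re (cinner t (y m))"
      unfolding t_sum cinner_sum_left Re_sum by (intro sum_nonneg funpow_pos)
    hence t_pos: "0 \<le> Re (cinner (y m) t)" by (simp add: Re_cinner_commute)
    have gd: "geom n d = t" by (simp add: d_def t_def geom_diff y)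
    have "g n - g m = Re (cinner (geom n (y n)) d)"
      by (simp add: g_def d_def cinner_diff_right y)
    also have "\<dots> = Re (cinner (y n) t)" by (simp add: geom_herm gd)
    also have "\<dots> = Re (cinner (y m) t) + Re (cinner d t)"
      by (simp add: d_def cinner_diff_left)
    also have "\<dots> \<ge> (norm d)\<^sup>2"
      using t_pos geom_ge[of d n] by (simp add: gd Re_cinner_commute)
    finally show ?thesis by (simp add: d_def)
  qed
  have "decseq g"
    unfolding decseq_def using dist_le by (metis diff_ge_0_iff_ge order_trans zero_le_power2)
  moreover have g0: "0 \<le> g n" for n using g_ge[of n] zero_le_power2 order_trans by blast
  ultimately obtain L where L: "g \<longlonglongrightarrow> L" using decseq_convergent by metis
  have "Cauchy y"
  proof (rule CauchyI)
    fix e :: real assume e: "e > 0"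
    from LIMSEQ_imp_Cauchy[OF L] obtain N where
      N: "\<And>i j. i \<ge> N \<Longrightarrow> j \<ge> N \<Longrightarrow> norm (g i - g j) < e\<^sup>2"
      using CauchyD[of _ "e\<^sup>2"] e by (metis zero_less_power)
    have "(norm (y i - y j))\<^sup>2 < e\<^sup>2" if "i \<ge> N" "j \<ge> N" for i j
      using N[OF that] dist_le[of i j] dist_le[of j i]
      by (cases "i \<le> j") (auto simp: norm_minus_commute[of "y j"])
    hence "norm (y i - y j) < e" if "i \<ge> N" "j \<ge> N" for i j
      using that e power2_less_imp_less[of "norm (y i - y j)" e] by simp
    thus "\<exists>N. \<forall>i\<ge>N. \<forall>j\<ge>N. norm (y i - y j) < e" by blast
  qed
  then obtain v where v: "y \<longlonglongrightarrow> v" using Cauchy_convergent_iff convergent_def by blast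
  \<comment> \<open>For \<open>n \<ge> 2 * j\<close> the power \<open>B ^^ (j + j)\<close> is one of
    the positive terms of \<open>geom n\<close>, which bounds \<open>(B ^^ j) (y n)\<close> by
    \<open>norm x\<close> uniformly.\<close>
  have "norm ((B ^^ j) v) \<le> norm x" for j
  proof (rule LIMSEQ_le_const2)
    show "(\<lambda>n. norm ((B ^^ j) (y n))) \<longlonglongrightarrow> norm ((B ^^ j) v)"
      by (intro tendsto_norm bounded_linear.tendsto[OF funpow_bounded_linear] v)
    show "\<exists>N. \<forall>n\<ge>N. norm ((B ^^ j) (y n)) \<le> norm x"
    proof (intro exI[of _ "j + j"] allI impI)
      fix n assume n: "j + j \<le> n"
      have "(norm ((B ^^ j) (y n)))\<^sup>2 = Re (cinner ((B ^^ (j + j)) (y n)) (y n))"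
        using funpow_herm[of j "(B ^^ j) (y n)" "y n"] by (simp add: funpow_add Re_cinner_self)
      also have "\<dots> \<le> g n" unfolding g_geom by (rule geom_ge_term[OF n])
      also have "\<dots> \<le> (norm x)\<^sup>2" by (rule g_le)
      finally show "norm ((B ^^ j) (y n)) \<le> norm x" by (rule power2_le_imp_le) simp
    qed
  qed
  hence "v \<in> growth 1" unfolding growth_iff[OF zero_le_one] by (intro exI[of _ "norm x"]) simp
  hence "cinner x v = 0" using orth cinner_zero_commute by blast
  moreover have "g \<longlonglongrightarrow> Re (cinner x v)"
    unfolding g_def by (intro tendsto_Re tendsto_cinner_right v)
  ultimately have g_lim: "g \<longlonglongrightarrow> 0" by simp
  have "- g n \<le> Re (cinner (B x - x) x)" for n
  proof -
    \<comment> \<open>Telescoping. Pairing the result with \<open>x = geom n (y n)\<close> leaves a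
      nonnegative term and \<open>- g n\<close>, and \<open>g\<close> tends to \<open>0\<close>
      because \<open>x\<close> is orthogonal to \<open>v\<close>.\<close>
    have "B (geom n u) - geom n u = (B ^^ Suc n) u - u" for u
      by (induction n)
        (simp_all add: geom_def linear_add[OF bops_linear[OF B_bops]] algebra_simps)
    hence "B x - x = (B ^^ Suc n) (y n) - y n" using y[of n] by metis
    hence "Re (cinner (B x - x) x) = Re (cinner ((B ^^ Suc n) (y n)) (geom n (y n))) - Re (cinner (y n) x)"
      by (simp only: cinner_diff_left y minus_complex.sel)
    moreover have "0 \<le> Re (cinner ((B ^^ Suc n) (y n)) (geom n (y n)))"
      unfolding geom_def cinner_sum_right Re_sum by (intro sum_nonneg funpow_pos2)
    ultimately show ?thesis by (simp add: g_def Re_cinner_commute[of x])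
  qed
  hence "- 0 \<le> Re (cinner (B x - x) x)"
    by (intro LIMSEQ_le_const2[OF tendsto_minus[OF g_lim]]) auto
  thus ?thesis by (simp add: cinner_diff_left Re_cinner_self)
qed

text \<open>Rescaling by \<open>1 / r\<close> reduces to level one; at \<open>r = 0\<close> the
  claim is positivity.\<close>

lemma lower_bound:
  assumes r: "0 \<le> r" and orth: "\<And>z. z \<in> growth r \<Longrightarrow> cinner z x = 0"
  shows "r * (norm x)\<^sup>2 \<le> Re (cinner (B x) x)"
proof (cases "r = 0")
  case True
  thus ?thesis using pos[of x] by simp
next
  case False
  hence r0: "r > 0" using r by simp
  define C where "C y = (1 / r) *\<^sub>R B y" for y
  interpret C: positive_hermitian C
  proof
    have "clinear C"
      using clinearD[OF bops_clinear[OF B_bops]]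
      by (simp add: clinear_def C_def scaleC_add_right scaleR_scaleC scaleC_scaleC mult.commute)
    moreover have "bounded_linear C"
      unfolding C_def by (rule bounded_linear_const_scaleR[OF bops_bounded_linear[OF B_bops]])
    ultimately show "C \<in> bops" by (rule bopsI)
    show "cinner (C x) y = cinner x (C y)" for x y
      by (simp add: C_def cinner_scaleR_left cinner_scaleR_right herm)
    show "0 \<le> Re (cinner (C x) x)" for x
      using pos[of x] r0 by (simp add: C_def cinner_scaleR_left)
  qed
  have "(C ^^ n) y = (1 / r) ^ n *\<^sub>R (B ^^ n) y" for n y
    by (induction n) (simp_all add: C_def linear_scale[OF bops_linear[OF B_bops]])
  hence "C.growth 1 \<subseteq> growth r"
    using r0 by (auto simp: C.growth_def growth_def field_simps)
  hence "(norm x)\<^sup>2 \<le> Re (cinner (C x) x)"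
    by (intro C.lower_bound_one orth) auto
  thus ?thesis using r0 by (simp add: C_def cinner_scaleR_left field_simps)
qed

end

text \<open>The subspaces are exposed, with invariance under every bounded operator commuting with
  \<open>A\<close>, because this is the input that \<open>orth_proj_in_vN\<close> takes to put the
  projections into the algebra.\<close>

theorem spectral_theorem:
  fixes A :: "'h::chilbert_space \<Rightarrow> 'h"
  assumes A: "A \<in> bops" "adj A = A"
  obtains M where "spectral_family_of A (\<lambda>l. orth_proj (M l))" "\<And>l. closed_csubspace (M l)"
    "\<And>T l x. T \<in> bops \<Longrightarrow> (\<And>x. T (A x) = A (T x)) \<Longrightarrow> x \<in> M l \<Longrightarrow> T x \<in> M l"
proof -
  obtain K where K: "\<And>x. norm (A x) \<le> norm x * K" "K > 0"
    using bounded_linear.pos_bounded[OF bops_bounded_linear[OF A(1)]] by blast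
  \<comment> \<open>With \<open>K\<close> alone \<open>B\<close> would only be nonnegative; the
    extra \<open>1\<close> gives \<open>B \<ge> 1\<close> as a form, so \<open>growth 0\<close> is
    trivial and \<open>E\<close> vanishes at \<open>- c\<close>.\<close>
  define c where "c = K + 1"
  define B where "B x = A x + c *\<^sub>R x" for x
  have c: "c > 0" using K by (simp add: c_def)
  have B_ge: "(norm x)\<^sup>2 \<le> Re (cinner (B x) x)" for x
  proof -
    have "- Re (cinner (A x) x) \<le> norm (- A x) * norm x"
      using Re_cinner_le[of "- A x" x] cinner_diff_left[of 0 "A x" x] by simp
    also have "\<dots> \<le> norm x * K * norm x"
      by (intro mult_right_mono) (use K in auto)
    finally show ?thesis
      by (simp add: B_def c_def cinner_add_left cinner_scaleR_left Re_cinner_self power2_eq_square algebra_simps)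
  qed
  interpret positive_hermitian B
  proof
    have "clinear B"
      using clinearD[OF bops_clinear[OF A(1)]]
      by (simp add: clinear_def B_def scaleC_add_right scaleR_scaleC scaleC_scaleC mult.commute)
    moreover have "bounded_linear B"
      unfolding B_def
      by (intro bounded_linear_add bounded_linear_scaleR_right bops_bounded_linear[OF A(1)])
    ultimately show "B \<in> bops" by (rule bopsI)
    show "cinner (B x) y = cinner x (B y)" for x y
      by (simp add: B_def cinner_add_left cinner_add_right cinner_scaleR_left cinner_scaleR_right
          cinner_hermitian[OF A])
    show "0 \<le> Re (cinner (B x) x)" for x
      using B_ge[of x] zero_le_power2 order_trans by blast
  qed
  define b where "b = K + c"
  have norm_B: "norm (B x) \<le> b * norm x" for x
    using norm_triangle_ineq[of "A x" "c *\<^sub>R x"] K(1)[of x] c by (simp add: B_def b_def algebra_simps)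
  \<comment> \<open>The cutoff \<open>max 0\<close> keeps the radius in the range where growth sets
    are closed subspaces.\<close>
  define M where "M l = growth (max 0 (l + c))" for l
  define E where "E l = orth_proj (M l)" for l
  have M: "closed_csubspace (M l)" for l unfolding M_def by (rule closed_csubspace_growth) simp
  have fixE: "E l x = x \<longleftrightarrow> x \<in> M l" for l x unfolding E_def by (rule orth_proj_fixes_iff[OF M])
  have inv: "T x \<in> M l" if "T \<in> bops" "\<And>x. T (A x) = A (T x)" "x \<in> M l" for T l x
    unfolding M_def
  proof (rule growth_invariant[where T = T])
    show "T (B x) = B (T x)" for x
      using bops_linear[OF that(1)] by (simp add: B_def linear_add linear_scale that(2))
  qed (use that in \<open>auto simp: M_def\<close>)
  have AM: "A x \<in> M l" if "x \<in> M l" for x l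
    by (rule inv) (use A that in auto)
  interpret E: projection_family E
  proof
    show pr: "is_projection (E l)" for l unfolding E_def by (rule is_projection_orth_proj[OF M])
    show "proj_le (E l) (E m)" if "l \<le> m" for l m
    proof -
      have "max 0 (l + c) \<le> max 0 (m + c)" using that by simp
      from growth_mono[OF _ this] show ?thesis unfolding proj_le_fixes[OF pr pr] fixE by (auto simp: M_def)
    qed
  qed
  have "spectral_family_of A E"
  proof (rule E.spectral_family_ofI)
    show "((\<lambda>m. E m x) \<longlongrightarrow> E l x) (at_right l)" for l x
    proof (rule E.strongly_right_continuous)
      fix x assume x: "\<And>m. l < m \<Longrightarrow> E m x = x"
      have "norm ((B ^^ n) x) \<le> (max 0 (l + c)) ^ n * norm x" for n
      proof (rule tendsto_lowerbound[OF _ _ trivial_limit_at_right_real])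
        show "((\<lambda>m. (max 0 (m + c)) ^ n * norm x) \<longlongrightarrow> (max 0 (l + c)) ^ n * norm x) (at_right l)"
          by (intro tendsto_intros tendsto_max)
        show "\<forall>\<^sub>F m in at_right l. norm ((B ^^ n) x) \<le> (max 0 (m + c)) ^ n * norm x"
          using x unfolding fixE M_def growth_def
          by (auto simp: eventually_at_right_field intro!: exI[of _ "l + 1"])
      qed
      thus "E l x = x" by (simp add: fixE M_def growth_def)
    qed
    show "- c < b" using K c by (simp add: b_def)
    show "E l = (\<lambda>x. 0)" if "l \<le> - c" for l
    proof
      fix x
      have "E l x \<in> M l" unfolding E_def by (rule orth_proj_in[OF M])
      moreover have "max 0 (l + c) = 0" using that by simp
      ultimately have "E l x \<in> growth 0" by (simp only: M_def)
      hence "norm ((B ^^ 1) (E l x)) \<le> 0 ^ 1 * norm (E l x)" unfolding growth_def by blast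
      thus "E l x = 0" using B_ge[of "E l x"] by simp
    qed
    show "E l = id" if "l \<ge> b" for l
    proof
      fix x
      have "norm ((B ^^ n) x) \<le> (max 0 (l + c)) ^ n * norm x" for n
      proof (induction n)
        case (Suc n)
        have "norm ((B ^^ Suc n) x) \<le> max 0 (l + c) * norm ((B ^^ n) x)"
          using order_trans[OF norm_B[of "(B ^^ n) x"] mult_right_mono[of b "max 0 (l + c)"]] that c
          by (simp add: le_max_iff_disj)
        also have "\<dots> \<le> max 0 (l + c) * (max 0 (l + c) ^ n * norm x)"
          by (intro mult_left_mono Suc) simp
        finally show ?case by simp
      qed simp
      thus "E l x = id x" by (simp add: fixE M_def growth_def)
    qed
    show "linear A" by (rule bops_linear[OF A(1)])
    show "A (E l x) = E l (A x)" for l x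
      unfolding E_def using AM A by (intro orth_proj_commute[OF M]) auto
    \<comment> \<open>The factor \<open>3\<close> bounds \<open>2 * m' + l'\<close> below, where
      \<open>m'\<close> and \<open>l'\<close> are shifted levels of size at most
      \<open>b + c\<close>.\<close>
    show "0 \<le> 3 * (b + c)" using K c by (simp add: b_def)
    fix l m t x assume *: "- c \<le> l" "l \<le> t" "t \<le> m" "m \<le> b" "E m x = x" "E l x = 0"
    define l' t' m' where "l' = l + c" and "t' = t + c" and "m' = m + c"
    have ord: "0 \<le> l'" "l' \<le> t'" "t' \<le> m'" "m' \<le> b + c" "m' - l' = m - l"
      using * by (auto simp: l'_def t'_def m'_def)
    have "x \<in> growth m'" using *(5) ord unfolding fixE by (simp add: M_def m'_def)
    hence "norm ((B ^^ 1) x) \<le> m' ^ 1 * norm x" unfolding growth_def by blast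
    hence "(norm (B x))\<^sup>2 \<le> (m' * norm x)\<^sup>2" by (intro power_mono) auto
    hence up: "(norm (B x))\<^sup>2 \<le> m'\<^sup>2 * (norm x)\<^sup>2" by (simp add: power_mult_distrib)
    have low: "l' * (norm x)\<^sup>2 \<le> Re (cinner (B x) x)"
    proof (rule lower_bound[OF ord(1)])
      fix z assume "z \<in> growth l'"
      hence "z \<in> M l" using ord(1) by (simp add: M_def l'_def)
      thus "cinner z x = 0" using orth_proj_orth[OF M, of z l x] *(6) by (simp add: E_def)
    qed
    \<comment> \<open>Expanding the square needs only the norm bound \<open>up\<close> and the form
      bound \<open>low\<close>.\<close>
    have "A x - t *\<^sub>R x = B x - t' *\<^sub>R x" by (simp add: B_def t'_def algebra_simps)
    hence "(norm (A x - t *\<^sub>R x))\<^sup>2 = (norm (B x))\<^sup>2 - 2 * (t' * Re (cinner (B x) x)) + t'\<^sup>2 * (norm x)\<^sup>2"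
      by (simp add: norm_diff_sq cinner_scaleR_right power_mult_distrib)
    also have "\<dots> \<le> m'\<^sup>2 * (norm x)\<^sup>2 - 2 * (t' * (l' * (norm x)\<^sup>2)) + t'\<^sup>2 * (norm x)\<^sup>2"
      using up mult_left_mono[OF low, of t'] ord by simp
    also have "\<dots> = (m'\<^sup>2 - 2 * t' * l' + t'\<^sup>2) * (norm x)\<^sup>2" by (simp add: algebra_simps)
    also have "\<dots> \<le> 3 * (b + c) * (m - l) * (norm x)\<^sup>2"
    proof (rule mult_right_mono)
      have "t' * (t' - l') \<le> m' * (m' - l')" using ord by (intro mult_mono) auto
      moreover have "l' * l' \<le> t' * l'" using ord by (intro mult_right_mono) auto
      ultimately have "m'\<^sup>2 - 2 * t' * l' + t'\<^sup>2 \<le> (m' * m' - l' * l') + m' * (m' - l')"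
        by (simp add: power2_eq_square algebra_simps)
      also have "\<dots> = (m' + l' + m') * (m' - l')" by (simp add: algebra_simps)
      also have "\<dots> \<le> 3 * (b + c) * (m' - l')" using ord by (intro mult_right_mono) auto
      finally show "m'\<^sup>2 - 2 * t' * l' + t'\<^sup>2 \<le> 3 * (b + c) * (m - l)" using ord by simp
    qed simp
    finally show "(norm (A x - t *\<^sub>R x))\<^sup>2 \<le> 3 * (b + c) * (m - l) * (norm x)\<^sup>2" .
  qed
  thus ?thesis using that[of M] M inv unfolding E_def by blast
qed

section \<open>Quasipoints\<close>

text \<open>Nontriviality separates \<open>id\<close> from zero and so puts \<open>id\<close> into
  every quasipoint. On the zero space the empty set is the only quasipoint and no basic set covers
  it; all real functions on it then count as bounded continuous, but only one is observable.\<close>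

locale nontrivial_vN =
  fixes R :: "('h::chilbert_space \<Rightarrow> 'h) set"
  assumes vN: "von_neumann_algebra R" and nontrivial: "\<exists>x::'h. x \<noteq> 0"
begin

lemmas proj_of = projectionsD[OF vN]
lemmas meet_in = proj_meet_in[OF vN]
lemmas meet_fixes = proj_meet_fixes[OF vN]
lemmas meet_le = proj_meet_le[OF vN]
lemmas le_meet_iff = proj_le_meet_iff[OF vN]
lemmas compl_in = projections_compl[OF vN]

lemma spectral_family_vN:
  assumes A: "A \<in> self_adjoints R"
  shows "spectral_family_of A (spectral_family A)" "spectral_family A l \<in> projections R"
proof -
  have Ab: "A \<in> bops" "adj A = A" "A \<in> R" using A vN_bops[OF vN] by (auto simp: self_adjoints_def)
  obtain M where sf: "spectral_family_of A (\<lambda>l. orth_proj (M l))" and M: "\<And>l. closed_csubspace (M l)"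
    and inv: "\<And>T l x. T \<in> bops \<Longrightarrow> (\<And>x. T (A x) = A (T x)) \<Longrightarrow> x \<in> M l \<Longrightarrow> T x \<in> M l"
    using spectral_theorem[OF Ab(1,2)] by metis
  have eq: "spectral_family A = (\<lambda>l. orth_proj (M l))"
    by (rule spectral_family_unique[OF Ab(1) sf])
  show "spectral_family_of A (spectral_family A)" unfolding eq by (rule sf)
  show "spectral_family A l \<in> projections R"
    unfolding eq
  proof (rule orth_proj_in_vN[OF vN M])
    fix T x assume T: "T \<in> commutant R" and "x \<in> M l"
    thus "T x \<in> M l" using inv[OF commutant_bops[OF T]] commutantD[OF T Ab(3)] by blast
  qed
qed

lemma le_zero_iff:
  assumes "P \<in> projections R"
  shows "proj_le P (\<lambda>x. 0) \<longleftrightarrow> P = (\<lambda>x. 0)"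
  using linear_0[OF is_projectionD(4)[OF proj_of[OF assms]]] by (auto simp: proj_le_def fun_eq_iff)

lemma eq_zero_iff:
  assumes "P \<in> projections R"
  shows "P = (\<lambda>x. 0) \<longleftrightarrow> (\<forall>x. P x = x \<longrightarrow> x = 0)"
  using is_projectionD(2)[OF proj_of[OF assms]] by (auto simp: fun_eq_iff)

lemma id_neq_zero: "id \<noteq> (\<lambda>x::'h. 0)"
  using nontrivial by (auto simp: fun_eq_iff)

lemma meet_zero_iff:
  assumes "P \<in> projections R" "Q \<in> projections R"
  shows "proj_meet R P Q = (\<lambda>x. 0) \<longleftrightarrow> (\<forall>x. P x = x \<and> Q x = x \<longrightarrow> x = 0)"
  unfolding eq_zero_iff[OF meet_in[OF assms]] meet_fixes[OF assms] ..

lemma filter_base_iff: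
  "filter_base R B \<longleftrightarrow> B \<subseteq> projections R \<and> (\<lambda>x. 0) \<notin> B \<and>
     (\<forall>P\<in>B. \<forall>Q\<in>B. \<exists>S\<in>B. proj_le S P \<and> proj_le S Q)"
  unfolding filter_base_def using le_meet_iff by (meson subsetD)

lemma quasipointD:
  assumes "B \<in> quasipoints R"
  shows "filter_base R B" "B \<subseteq> projections R" "(\<lambda>x. 0) \<notin> B"
    "P \<in> B \<Longrightarrow> Q \<in> B \<Longrightarrow> \<exists>S\<in>B. proj_le S P \<and> proj_le S Q"
    "filter_base R C \<Longrightarrow> B \<subseteq> C \<Longrightarrow> C = B"
  using assms unfolding quasipoints_def filter_base_iff by blast+

text \<open>Adjoining a larger projection keeps a filter base, so maximality has already included
  it.\<close>

lemma quasipoint_upward: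
  assumes B: "B \<in> quasipoints R" and P: "P \<in> B" and Q: "Q \<in> projections R" and le: "proj_le P Q"
  shows "Q \<in> B"
proof -
  note D = quasipointD[OF B]
  have PL: "P \<in> projections R" using P D(2) by auto
  have "filter_base R (insert Q B)"
    unfolding filter_base_iff
  proof (intro conjI ballI)
    show "insert Q B \<subseteq> projections R" using D(2) Q by auto
    have "Q \<noteq> (\<lambda>x. 0)" using le le_zero_iff[OF PL] P D(3) by auto
    thus "(\<lambda>x. 0) \<notin> insert Q B" using D(3) by auto
    fix X Y assume XY: "X \<in> insert Q B" "Y \<in> insert Q B"
    have below: "\<exists>Z'\<in>B. proj_le Z' Z" if "Z \<in> insert Q B" for Z
      using that P le D(2) proj_le_refl[OF proj_of] by blast
    obtain X' Y' where *: "X' \<in> B" "Y' \<in> B" "proj_le X' X" "proj_le Y' Y"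
      using below[OF XY(1)] below[OF XY(2)] by blast
    obtain S where "S \<in> B" "proj_le S X'" "proj_le S Y'" using D(4)[OF *(1,2)] by blast
    thus "\<exists>S\<in>insert Q B. proj_le S X \<and> proj_le S Y" using * proj_le_trans by blast
  qed
  hence "insert Q B = B" by (rule D(5)) auto
  thus ?thesis by auto
qed

lemma quasipoint_id:
  assumes B: "B \<in> quasipoints R"
  shows "id \<in> B"
proof -
  note D = quasipointD[OF B]
  have le_id: "proj_le P id" for P :: "'h \<Rightarrow> 'h" by (simp add: proj_le_def)
  have "filter_base R (insert id B)"
    unfolding filter_base_iff
  proof (intro conjI ballI)
    show "insert id B \<subseteq> projections R" using D(2) projections_id[OF vN] by auto
    show "(\<lambda>x. 0) \<notin> insert id B" using D(3) id_neq_zero by auto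
    fix X Y assume "X \<in> insert id B" "Y \<in> insert id B"
    thus "\<exists>S\<in>insert id B. proj_le S X \<and> proj_le S Y"
      using D(4)[of X Y] le_id proj_le_refl[OF proj_of] D(2) by blast
  qed
  hence "insert id B = B" by (rule D(5)) auto
  thus ?thesis by auto
qed

lemma quasipoint_meet:
  assumes B: "B \<in> quasipoints R" and P: "P \<in> B" and Q: "Q \<in> B"
  shows "proj_meet R P Q \<in> B"
proof -
  note D = quasipointD[OF B]
  have L: "P \<in> projections R" "Q \<in> projections R" using P Q D(2) by auto
  obtain S where S: "S \<in> B" "proj_le S P" "proj_le S Q" using D(4)[OF P Q] by blast
  hence "proj_le S (proj_meet R P Q)" using le_meet_iff[OF L] D(2) by auto
  thus ?thesis using quasipoint_upward[OF B S(1) meet_in[OF L]] by simp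
qed

lemma quasipoint_not_disjoint:
  assumes "B \<in> quasipoints R" "P \<in> B" "Q \<in> B"
  shows "proj_meet R P Q \<noteq> (\<lambda>x. 0)"
  using quasipoint_meet[OF assms] quasipointD(3)[OF assms(1)] by auto

text \<open>If \<open>P\<close> met every member, the projections above the meets of
  \<open>P\<close> with members would form a filter base containing \<open>B\<close> and
  \<open>P\<close>, against maximality. This property makes the basic sets clopen.\<close>

lemma quasipoint_disjoint:
  assumes B: "B \<in> quasipoints R" and P: "P \<in> projections R" and notin: "P \<notin> B"
  shows "\<exists>X\<in>B. proj_meet R P X = (\<lambda>x. 0)"
proof (rule ccontr)
  assume "\<not> ?thesis"
  hence ne: "proj_meet R P X \<noteq> (\<lambda>x. 0)" if "X \<in> B" for X using that by blast
  note D = quasipointD[OF B]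
  have BL: "X \<in> projections R" if "X \<in> B" for X using that D(2) by auto
  define C where "C = {Y \<in> projections R. \<exists>X\<in>B. proj_le (proj_meet R P X) Y}"
  have "filter_base R C"
    unfolding filter_base_iff
  proof (intro conjI ballI)
    show "C \<subseteq> projections R" by (auto simp: C_def)
    show "(\<lambda>x. 0) \<notin> C"
      using ne le_zero_iff[OF meet_in[OF P BL]] by (auto simp: C_def)
    fix Y1 Y2 assume "Y1 \<in> C" "Y2 \<in> C"
    then obtain X1 X2 where X: "X1 \<in> B" "X2 \<in> B"
      and le: "proj_le (proj_meet R P X1) Y1" "proj_le (proj_meet R P X2) Y2"
      by (auto simp: C_def)
    define X where "X = proj_meet R X1 X2"
    have XB: "X \<in> B" unfolding X_def by (rule quasipoint_meet[OF B X])
    have XL: "X \<in> projections R" by (rule BL[OF XB])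
    have X_le: "proj_le X X1" "proj_le X X2" unfolding X_def by (intro meet_le BL X)+
    have mono: "proj_le (proj_meet R P X) (proj_meet R P X')" if "proj_le X X'" "X' \<in> B" for X'
      unfolding le_meet_iff[OF P BL[OF that(2)] meet_in[OF P XL]]
      using meet_le[OF P XL] that proj_le_trans by blast
    have "proj_meet R P X \<in> C"
      unfolding C_def using meet_in[OF P XL] XB proj_le_refl[OF proj_of] by blast
    thus "\<exists>S\<in>C. proj_le S Y1 \<and> proj_le S Y2"
      using mono[OF X_le(1) X(1)] mono[OF X_le(2) X(2)] le proj_le_trans by blast
  qed
  moreover have "B \<subseteq> C" using BL meet_le(2)[OF P] by (auto simp: C_def)
  ultimately have "C = B" by (rule D(5))
  moreover have "P \<in> C" using P quasipoint_id[OF B] meet_le(1)[OF P BL] by (auto simp: C_def)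
  ultimately show False using notin by simp
qed

lemma quasipoint_exists:
  assumes G: "G \<in> projections R" "G \<noteq> (\<lambda>x. 0)"
  shows "\<exists>B\<in>quasipoints R. G \<in> B"
proof -
  let ?A = "{C. filter_base R C \<and> G \<in> C}"
  have "\<exists>M\<in>?A. \<forall>X\<in>?A. M \<subseteq> X \<longrightarrow> X = M"
  proof (rule subset_Zorn_nonempty)
    have "filter_base R {G}"
      unfolding filter_base_iff using G proj_le_refl[OF proj_of[OF G(1)]] by auto
    thus "?A \<noteq> {}" by blast
    fix \<C> assume ne: "\<C> \<noteq> {}" and ch: "subset.chain ?A \<C>"
    hence sub: "\<And>C. C \<in> \<C> \<Longrightarrow> filter_base R C \<and> G \<in> C"
      and tot: "\<And>C D. C \<in> \<C> \<Longrightarrow> D \<in> \<C> \<Longrightarrow> C \<subseteq> D \<or> D \<subseteq> C"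
      unfolding subset.chain_def by blast+
    have "filter_base R (\<Union>\<C>)"
      unfolding filter_base_iff
    proof (intro conjI ballI)
      show "\<Union>\<C> \<subseteq> projections R" "(\<lambda>x. 0) \<notin> \<Union>\<C>" using sub unfolding filter_base_iff by blast+
      fix P Q assume "P \<in> \<Union>\<C>" "Q \<in> \<Union>\<C>"
      then obtain C where C: "C \<in> \<C>" "P \<in> C" "Q \<in> C" using tot by blast
      hence "\<exists>S\<in>C. proj_le S P \<and> proj_le S Q" using sub[OF C(1)] unfolding filter_base_iff by blast
      thus "\<exists>S\<in>\<Union>\<C>. proj_le S P \<and> proj_le S Q" using C(1) by blast
    qed
    thus "\<Union>\<C> \<in> ?A" using ne sub by blast
  qed
  then obtain M where M: "filter_base R M" "G \<in> M"
    and max: "\<And>X. filter_base R X \<Longrightarrow> G \<in> X \<Longrightarrow> M \<subseteq> X \<Longrightarrow> X = M" by blast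
  have "M \<in> quasipoints R"
    unfolding quasipoints_def using M max by blast
  thus ?thesis using M(2) by blast
qed

subsection \<open>The Stone topology\<close>

lemma openin_qp_basic: "P \<in> projections R \<Longrightarrow> openin (qp_topology R) (qp_basic R P)"
  unfolding qp_topology_def openin_topology_generated_by_iff by (rule generate_topology_on.Basis) blast

text \<open>The topology is generated from the basic sets as a subbase; closure of quasipoints under
  meets makes them a base.\<close>

lemma openin_imp_basic:
  assumes "openin (qp_topology R) U"
  shows "U \<subseteq> quasipoints R \<and> (\<forall>B\<in>U. \<exists>P\<in>B. qp_basic R P \<subseteq> U)"
proof -
  have "generate_topology_on {qp_basic R P | P. P \<in> projections R} U"
    using assms unfolding qp_topology_def openin_topology_generated_by_iff .
  thus ?thesis
  proof induction
    case (Int U V)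
    have "\<exists>P\<in>B. qp_basic R P \<subseteq> U \<inter> V" if B: "B \<in> U \<inter> V" for B
    proof -
      have BUV: "B \<in> U" "B \<in> V" using B by auto
      have BQ: "B \<in> quasipoints R" using BUV(1) Int.IH(1) by blast
      obtain P where P: "P \<in> B" "qp_basic R P \<subseteq> U" using Int.IH(1) BUV(1) by blast
      obtain Q where Q: "Q \<in> B" "qp_basic R Q \<subseteq> V" using Int.IH(2) BUV(2) by blast
      note PQ = P(1) Q(1) P(2) Q(2)
      have L: "P \<in> projections R" "Q \<in> projections R" using PQ quasipointD(2)[OF BQ] by auto
      have "qp_basic R (proj_meet R P Q) \<subseteq> qp_basic R P \<inter> qp_basic R Q"
        using quasipoint_upward[OF _ _ L(1) meet_le(1)[OF L]] quasipoint_upward[OF _ _ L(2) meet_le(2)[OF L]]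
        by (auto simp: qp_basic_def)
      thus ?thesis using quasipoint_meet[OF BQ PQ(1,2)] PQ by blast
    qed
    thus ?case using Int.IH(1) by blast
  next
    case (UN K)
    have "\<exists>P\<in>B. qp_basic R P \<subseteq> \<Union>K" if B: "B \<in> \<Union>K" for B
    proof -
      obtain U where U: "U \<in> K" "B \<in> U" using B by blast
      then obtain P where "P \<in> B" "qp_basic R P \<subseteq> U" using UN.IH by blast
      thus ?thesis using U(1) by blast
    qed
    thus ?case using UN.IH by blast
  next
    case (Basis U)
    thus ?case by (auto simp: qp_basic_def)
  qed simp
qed

lemma topspace_qp: "topspace (qp_topology R) = quasipoints R"
proof
  show "topspace (qp_topology R) \<subseteq> quasipoints R"
    using openin_imp_basic[OF openin_topspace] by blast
  have "qp_basic R id \<subseteq> topspace (qp_topology R)"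
    by (rule openin_subset[OF openin_qp_basic[OF projections_id[OF vN]]])
  thus "quasipoints R \<subseteq> topspace (qp_topology R)"
    using quasipoint_id by (auto simp: qp_basic_def)
qed

lemma openin_qpI:
  assumes "U \<subseteq> quasipoints R" "\<And>B. B \<in> U \<Longrightarrow> \<exists>P\<in>B. qp_basic R P \<subseteq> U"
  shows "openin (qp_topology R) U"
proof (subst openin_subopen, intro ballI)
  fix B assume B: "B \<in> U"
  then obtain P where P: "P \<in> B" "qp_basic R P \<subseteq> U" using assms(2) by blast
  have "P \<in> projections R" "B \<in> qp_basic R P"
    using P B assms(1) quasipointD(2) by (auto simp: qp_basic_def)
  thus "\<exists>T. openin (qp_topology R) T \<and> B \<in> T \<and> T \<subseteq> U" using openin_qp_basic P(2) by blast
qed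

lemma openin_qp_basic_compl:
  assumes P: "P \<in> projections R"
  shows "openin (qp_topology R) {B \<in> quasipoints R. P \<notin> B}"
proof (rule openin_qpI)
  fix B assume B: "B \<in> {B \<in> quasipoints R. P \<notin> B}"
  then obtain X where X: "X \<in> B" "proj_meet R P X = (\<lambda>x. 0)" using quasipoint_disjoint[OF _ P] by blast
  thus "\<exists>X\<in>B. qp_basic R X \<subseteq> {B \<in> quasipoints R. P \<notin> B}"
    using quasipoint_not_disjoint by (auto simp: qp_basic_def)
qed auto

lemma bounded_continuous_functions_iff:
  "f \<in> bounded_continuous_functions R \<longleftrightarrow> f \<in> extensional (quasipoints R) \<and>
     (\<forall>a. openin (qp_topology R) {B \<in> quasipoints R. a < f B}) \<and>
     (\<forall>a. openin (qp_topology R) {B \<in> quasipoints R. f B < a}) \<and> bounded (f ` quasipoints R)"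
  unfolding bounded_continuous_functions_def continuous_map_upper_lower_semicontinuous_lt topspace_qp by auto

section \<open>Observable functions\<close>

context
  fixes A assumes A: "A \<in> self_adjoints R"
begin

lemma spectral_family_quasipoint_mono:
  assumes "B \<in> quasipoints R" "spectral_family A l \<in> B" "l \<le> m"
  shows "spectral_family A m \<in> B"
  using quasipoint_upward[OF assms(1,2) spectral_family_vN(2)[OF A]] spectral_family_vN(1)[OF A] assms(3)
  by (simp add: spectral_family_of_def)

lemma spectral_family_bounds:
  obtains a b where "\<And>B l. B \<in> quasipoints R \<Longrightarrow> spectral_family A l \<in> B \<Longrightarrow> a \<le> l"
    "\<And>B. B \<in> quasipoints R \<Longrightarrow> spectral_family A b \<in> B"
proof -
  have "A \<in> bops" using A vN_bops[OF vN] by (auto simp: self_adjoints_def)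
  then obtain a b where "\<And>l. l \<le> a \<Longrightarrow> spectral_family A l = (\<lambda>x. 0)" "\<And>l. l \<ge> b \<Longrightarrow> spectral_family A l = id"
    using spectral_family_ofE[OF _ spectral_family_vN(1)[OF A]] by metis
  thus ?thesis using that[of a b] quasipointD(3) quasipoint_id by (metis linear order_refl)
qed

text \<open>The levels whose projection lies in \<open>B\<close> form an upward closed, nonempty set
  bounded below. Both strict inequalities thus become the existence of one level, which exhibits the
  corresponding sets as unions of clopen sets.\<close>

lemma
  assumes B: "B \<in> quasipoints R"
  shows obs_fun_less_iff: "obs_fun A B < r \<longleftrightarrow> (\<exists>l<r. spectral_family A l \<in> B)"
    and obs_fun_greater_iff: "r < obs_fun A B \<longleftrightarrow> (\<exists>l>r. spectral_family A l \<notin> B)"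
proof -
  obtain a b where "\<And>B l. B \<in> quasipoints R \<Longrightarrow> spectral_family A l \<in> B \<Longrightarrow> a \<le> l"
    "\<And>B. B \<in> quasipoints R \<Longrightarrow> spectral_family A b \<in> B" using spectral_family_bounds by blast
  hence ne: "{l. spectral_family A l \<in> B} \<noteq> {}" and bdd: "bdd_below {l. spectral_family A l \<in> B}"
    using B by (auto intro: bdd_belowI[of _ a])
  show "obs_fun A B < r \<longleftrightarrow> (\<exists>l<r. spectral_family A l \<in> B)"
    unfolding obs_fun_def cInf_less_iff[OF ne bdd] by auto
  show "r < obs_fun A B \<longleftrightarrow> (\<exists>l>r. spectral_family A l \<notin> B)"
  proof
    assume "r < obs_fun A B"
    then obtain l where l: "r < l" "l < obs_fun A B" using dense by blast
    have "spectral_family A l \<notin> B"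
      using cInf_lower[OF _ bdd, of l] l(2) by (auto simp: obs_fun_def)
    thus "\<exists>l>r. spectral_family A l \<notin> B" using l by blast
  next
    assume "\<exists>l>r. spectral_family A l \<notin> B"
    then obtain l where l: "r < l" "spectral_family A l \<notin> B" by blast
    have "l \<le> obs_fun A B"
      unfolding obs_fun_def
      using l(2) spectral_family_quasipoint_mono[OF B] by (intro cInf_greatest[OF ne]) (auto intro: leI less_imp_le)
    thus "r < obs_fun A B" using l by simp
  qed
qed

lemma obs_fun_bounded_continuous:
  "restrict (obs_fun A) (quasipoints R) \<in> bounded_continuous_functions R"
  unfolding bounded_continuous_functions_iff
proof (intro conjI allI)
  note L = spectral_family_vN(2)[OF A]
  fix r
  have "{B \<in> quasipoints R. r < restrict (obs_fun A) (quasipoints R) B} =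
      \<Union>((\<lambda>l. {B \<in> quasipoints R. spectral_family A l \<notin> B}) ` {r<..})"
    using obs_fun_greater_iff by auto
  thus "openin (qp_topology R) {B \<in> quasipoints R. r < restrict (obs_fun A) (quasipoints R) B}"
    using openin_qp_basic_compl[OF L] by (auto intro!: openin_Union)
  have "{B \<in> quasipoints R. restrict (obs_fun A) (quasipoints R) B < r} =
      \<Union>((\<lambda>l. qp_basic R (spectral_family A l)) ` {..<r})"
    using obs_fun_less_iff by (auto simp: qp_basic_def)
  thus "openin (qp_topology R) {B \<in> quasipoints R. restrict (obs_fun A) (quasipoints R) B < r}"
    using openin_qp_basic[OF L] by (auto intro!: openin_Union)
next
  obtain a b where ab: "\<And>B l. B \<in> quasipoints R \<Longrightarrow> spectral_family A l \<in> B \<Longrightarrow> a \<le> l"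
    "\<And>B. B \<in> quasipoints R \<Longrightarrow> spectral_family A b \<in> B" using spectral_family_bounds by blast
  have "a \<le> obs_fun A B \<and> obs_fun A B \<le> b" if B: "B \<in> quasipoints R" for B
  proof
    show "a \<le> obs_fun A B"
      using obs_fun_less_iff[OF B, of a] ab(1)[OF B] by (meson leD leI)
    show "obs_fun A B \<le> b"
      using obs_fun_greater_iff[OF B, of b] ab(2)[OF B] spectral_family_quasipoint_mono[OF B]
      by (meson leI less_imp_le)
  qed
  hence "restrict (obs_fun A) (quasipoints R) ` quasipoints R \<subseteq> {a..b}" by auto
  thus "bounded (restrict (obs_fun A) (quasipoints R) ` quasipoints R)"
    using bounded_subset bounded_closed_interval by blast
qed auto

end

subsection \<open>Surjectivity forces commutativity\<close>

text \<open>Invariance gives \<open>Q P Q = P Q\<close>; the left side is self-adjoint, so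
  \<open>P Q\<close> equals its adjoint \<open>Q P\<close>.\<close>

lemma projections_commute:
  assumes P: "is_projection P" and Q: "is_projection Q" and inv: "\<And>x. Q x = x \<Longrightarrow> Q (P x) = P x"
  shows "P (Q x) = Q (P x)"
proof (rule cinner_eqI)
  fix z
  note sym = is_projectionD(3)[OF P] is_projectionD(3)[OF Q]
  have QPQ: "Q (P (Q y)) = P (Q y)" for y by (rule inv) (rule is_projectionD(2)[OF Q])
  have "cinner z (P (Q x)) = cinner (Q (P (Q z))) x" by (metis QPQ sym)
  also have "\<dots> = cinner z (Q (P x))" by (metis QPQ sym)
  finally show "cinner z (P (Q x)) = cinner z (Q (P x))" .
qed

text \<open>\<open>G\<close> is the part of \<open>F\<close> orthogonal to the meet of
  \<open>F\<close> and \<open>E\<close>. If \<open>F\<close> is not below \<open>E\<close>, it is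
  nonzero and disjoint from \<open>E\<close>, so it yields a quasipoint containing \<open>F\<close>
  but not \<open>E\<close>.\<close>

lemma relative_complement:
  assumes F: "F \<in> projections R" and E: "E \<in> projections R"
  obtains G where "G \<in> projections R" "proj_le G F" "proj_meet R G E = (\<lambda>x. 0)"
    "\<And>x. F x = x \<Longrightarrow> G (x - proj_meet R F E x) = x - proj_meet R F E x"
proof -
  define N where "N = proj_meet R F E"
  have N: "N \<in> projections R" unfolding N_def by (rule meet_in[OF F E])
  note Np = proj_of[OF N]
  define G where "G = proj_meet R F (\<lambda>x. x - N x)"
  have G: "G \<in> projections R" unfolding G_def by (rule meet_in[OF F compl_in[OF N]])
  have G_fix: "G x = x \<longleftrightarrow> F x = x \<and> N x = 0" for x
    unfolding G_def meet_fixes[OF F compl_in[OF N]] by (simp add: diff_eq_eq)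
  have N_fix: "N x = x \<longleftrightarrow> F x = x \<and> E x = x" for x unfolding N_def by (rule meet_fixes[OF F E])
  have "proj_meet R G E = (\<lambda>x. 0)"
    unfolding meet_zero_iff[OF G E] G_fix using N_fix by metis
  moreover have "proj_le G F" unfolding proj_le_fixes[OF proj_of[OF G] proj_of[OF F]] G_fix by blast
  moreover have "G (x - N x) = x - N x" if "F x = x" for x
  proof -
    have "F (N x) = N x" using N_fix[of "N x"] is_projectionD(2)[OF Np] by blast
    thus ?thesis
      unfolding G_fix using that is_projectionD[OF proj_of[OF F]] is_projectionD[OF Np]
      by (simp add: linear_diff)
  qed
  ultimately show ?thesis using that[OF G] unfolding N_def by blast
qed

text \<open>If the complement of \<open>\<Q>\<^sub>P\<close> is \<open>\<Q>\<^sub>E\<close>, then \<open>E\<close> is the largest projection disjoint from \<open>P\<close>;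
  hence \<open>E = 1 - P\<close>, and every projection disjoint from \<open>P\<close> is orthogonal to \<open>P\<close>.\<close>

lemma complemented_imp_commute:
  assumes P: "P \<in> projections R" and E: "E \<in> projections R"
    and compl: "\<And>B. B \<in> quasipoints R \<Longrightarrow> P \<in> B \<longleftrightarrow> E \<notin> B" and Q: "Q \<in> projections R"
  shows "P (Q x) = Q (P x)"
proof (rule projections_commute[OF proj_of[OF P] proj_of[OF Q]])
  have le_E: "E x = x" if F: "F \<in> projections R" and disj: "proj_meet R F P = (\<lambda>x. 0)" and x: "F x = x" for F x
  proof (rule ccontr)
    assume Ex: "E x \<noteq> x"
    obtain G where G: "G \<in> projections R" "proj_le G F" "proj_meet R G E = (\<lambda>x. 0)"
      "\<And>x. F x = x \<Longrightarrow> G (x - proj_meet R F E x) = x - proj_meet R F E x"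
      using relative_complement[OF F E] by metis
    have "proj_meet R F E x \<noteq> x" using Ex meet_fixes[OF F E] by blast
    hence "G \<noteq> (\<lambda>x. 0)" using G(4)[OF x] by auto
    then obtain B where B: "B \<in> quasipoints R" "G \<in> B" using quasipoint_exists[OF G(1)] by blast
    have "F \<in> B" by (rule quasipoint_upward[OF B F G(2)])
    hence "P \<notin> B" using quasipoint_not_disjoint[OF B(1)] disj by blast
    hence "E \<in> B" using compl[OF B(1)] by blast
    thus False using quasipoint_not_disjoint[OF B] G(3) by blast
  qed
  have PE: "proj_meet R P E = (\<lambda>x. 0)"
  proof (rule ccontr)
    assume "proj_meet R P E \<noteq> (\<lambda>x. 0)"
    then obtain B where B: "B \<in> quasipoints R" "proj_meet R P E \<in> B"
      using quasipoint_exists[OF meet_in[OF P E]] by blast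
    have "P \<in> B" "E \<in> B" using quasipoint_upward[OF B] meet_le[OF P E] P E by blast+
    thus False using compl[OF B(1)] by blast
  qed
  note Pp = is_projectionD[OF proj_of[OF P]] and Ep = is_projectionD[OF proj_of[OF E]]
  have "proj_meet R (\<lambda>x. x - P x) P = (\<lambda>x. 0)"
    unfolding meet_zero_iff[OF compl_in[OF P] P] by auto
  hence E_ge: "E (x - P x) = x - P x" for x
    using le_E[OF compl_in[OF P]] Pp(2) linear_diff[OF Pp(4)] by simp
  \<comment> \<open>\<open>E\<close> fixes both \<open>x\<close> and \<open>x - P x\<close>, hence
    \<open>P x\<close>, which then lies in the ranges of \<open>P\<close> and
    \<open>E\<close>.\<close>
  have P_zero: "P x = 0" if "E x = x" for x
  proof -
    have "E (P x) = P x" using E_ge[of x] that linear_diff[OF Ep(4)] by simp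
    thus ?thesis using PE Pp(2) unfolding meet_zero_iff[OF P E] by blast
  qed
  fix x assume x: "Q x = x"
  obtain G where G: "G \<in> projections R" "proj_meet R G P = (\<lambda>x. 0)"
    "G (x - proj_meet R Q P x) = x - proj_meet R Q P x"
    using relative_complement[OF Q P] x by metis
  define N where "N = proj_meet R Q P"
  have NN: "N (N x) = N x" unfolding N_def by (rule is_projectionD(2)[OF proj_of[OF meet_in[OF Q P]]])
  hence N: "Q (N x) = N x" "P (N x) = N x" using meet_fixes[OF Q P] unfolding N_def by blast+
  \<comment> \<open>\<open>x - N x\<close> lies in the range of a projection disjoint from
    \<open>P\<close>, so \<open>P\<close> kills it; thus \<open>P x = N x\<close>, which is in the
    range of \<open>Q\<close>.\<close>
  have "P (x - N x) = 0"
    by (rule P_zero, rule le_E[OF G(1,2)]) (use G(3) in \<open>simp add: N_def\<close>)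
  hence "P x = N x" using N(2) linear_diff[OF Pp(4)] by simp
  thus "Q (P x) = P x" using N(1) by simp
qed

text \<open>Commutation passes from projections to self-adjoint elements through spectral families,
  then to all elements through real and imaginary parts.\<close>

lemma abelian_if_projections_commute:
  assumes comm: "\<And>P Q x. P \<in> projections R \<Longrightarrow> Q \<in> projections R \<Longrightarrow> P (Q x) = Q (P x)"
  shows "abelian R"
proof -
  have comm_sa: "T (A x) = A (T x)"
    if A: "A \<in> self_adjoints R" and T: "T \<in> bops" "\<And>P x. P \<in> projections R \<Longrightarrow> T (P x) = P (T x)" for A T x
  proof (rule spectral_family_of_commute[OF _ spectral_family_vN(1)[OF A] T(1)])
    show "A \<in> bops" using A vN_bops[OF vN] by (auto simp: self_adjoints_def)
    show "T (spectral_family A l x) = spectral_family A l (T x)" for l x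
      by (rule T(2)[OF spectral_family_vN(2)[OF A]])
  qed
  have sa_sa: "C (A x) = A (C x)" if A: "A \<in> self_adjoints R" and C: "C \<in> self_adjoints R" for A C x
  proof (rule comm_sa[OF A])
    show "C \<in> bops" using C vN_bops[OF vN] by (auto simp: self_adjoints_def)
    show "C (P x) = P (C x)" if "P \<in> projections R" for P x
      using comm_sa[OF C, of P x] is_projectionD(1)[OF proj_of[OF that]] comm[OF that] by simp
  qed
  have Rcl: "A \<in> R \<Longrightarrow> B \<in> R \<Longrightarrow> (\<lambda>x. A x + B x) \<in> R" "A \<in> R \<Longrightarrow> (\<lambda>x. c *\<^sub>C A x) \<in> R" for A B c
    using vN by (auto simp: von_neumann_algebra_def)
  have decomp: "\<exists>C\<in>self_adjoints R. \<exists>D\<in>self_adjoints R. \<forall>x. A x = C x + \<i> *\<^sub>C D x" if A: "A \<in> R" for A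
  proof -
    note Ab = vN_bops[OF vN A] and aR = vN_adj[OF vN A]
    define C where "C = (\<lambda>x. (1/2) *\<^sub>C A x + (1/2) *\<^sub>C adj A x)"
    define D where "D = (\<lambda>x. (-\<i>/2) *\<^sub>C A x + (\<i>/2) *\<^sub>C adj A x)"
    note simps = cinner_add_left cinner_add_right cinner_scaleC_left cinner_scaleC_right
      cinner_adj[OF Ab] cinner_adj_left[OF Ab]
    have "adj C = C" by (rule adj_eqI) (simp add: C_def simps)
    moreover have "C \<in> R" unfolding C_def by (intro Rcl A aR)
    moreover have "adj D = D" by (rule adj_eqI) (simp add: D_def simps)
    moreover have "D \<in> R" unfolding D_def by (intro Rcl A aR)
    moreover have "A x = C x + \<i> *\<^sub>C D x" for x
    proof -
      have "C x + \<i> *\<^sub>C D x = ((1/2) *\<^sub>C A x + (1/2) *\<^sub>C A x) + ((1/2) *\<^sub>C adj A x + (-1/2) *\<^sub>C adj A x)"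
        by (simp add: C_def D_def scaleC_add_right scaleC_scaleC)
      also have "\<dots> = A x"
        by (simp add: scaleC_one flip: scaleC_add_left)
      finally show ?thesis by simp
    qed
    ultimately show ?thesis unfolding self_adjoints_def by blast
  qed
  have any_sa: "B (A x) = A (B x)" if A: "A \<in> R" and B: "B \<in> self_adjoints R" for A B x
  proof -
    obtain C D where CD: "C \<in> self_adjoints R" "D \<in> self_adjoints R" "\<And>x. A x = C x + \<i> *\<^sub>C D x"
      using decomp[OF A] by blast
    have "clinear B" using B vN_bops[OF vN] bops_clinear by (auto simp: self_adjoints_def)
    thus ?thesis using sa_sa[OF CD(1) B] sa_sa[OF CD(2) B] by (simp add: CD(3) clinearD)
  qed
  have "A (B x) = B (A x)" if A: "A \<in> R" and B: "B \<in> R" for A B x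
  proof -
    obtain C D where CD: "C \<in> self_adjoints R" "D \<in> self_adjoints R" "\<And>x. B x = C x + \<i> *\<^sub>C D x"
      using decomp[OF B] by blast
    have "clinear A" by (rule bops_clinear[OF vN_bops[OF vN A]])
    thus ?thesis using any_sa[OF A CD(1)] any_sa[OF A CD(2)] by (simp add: CD(3) clinearD)
  qed
  thus ?thesis by (auto simp: abelian_def fun_eq_iff)
qed

lemma indicator_bounded_continuous:
  assumes P: "P \<in> projections R"
  shows "restrict (\<lambda>B. if P \<in> B then 1 else 0) (quasipoints R) \<in> bounded_continuous_functions R"
    (is "?f \<in> _")
  unfolding bounded_continuous_functions_iff
proof (intro conjI allI)
  have top: "openin (qp_topology R) (quasipoints R)" using openin_topspace[of "qp_topology R"] by (simp add: topspace_qp)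
  fix a
  have "{B \<in> quasipoints R. a < ?f B} = (if a < 0 then quasipoints R else if a < 1 then qp_basic R P else {})"
    by (auto simp: qp_basic_def)
  thus "openin (qp_topology R) {B \<in> quasipoints R. a < ?f B}" using top openin_qp_basic[OF P] by simp
  have "{B \<in> quasipoints R. ?f B < a} =
      (if a > 1 then quasipoints R else if a > 0 then {B \<in> quasipoints R. P \<notin> B} else {})"
    by auto
  thus "openin (qp_topology R) {B \<in> quasipoints R. ?f B < a}" using top openin_qp_basic_compl[OF P] by simp
next
  have "?f ` quasipoints R \<subseteq> {0, 1}" by auto
  thus "bounded (?f ` quasipoints R)" by (rule bounded_subset[rotated]) simp
qed auto

lemma abelian_if_surjective:
  assumes "bounded_continuous_functions R \<subseteq> observable_functions R"
  shows "abelian R"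
proof (rule abelian_if_projections_commute)
  fix P Q x assume P: "P \<in> projections R" and Q: "Q \<in> projections R"
  obtain A where A: "A \<in> self_adjoints R"
    and eq: "restrict (\<lambda>B. if P \<in> B then 1 else 0) (quasipoints R) = restrict (obs_fun A) (quasipoints R)"
    using indicator_bounded_continuous[OF P] assms unfolding observable_functions_def by blast
  have obs: "obs_fun A B = (if P \<in> B then 1 else 0)" if "B \<in> quasipoints R" for B
    using fun_cong[OF eq, of B] that by simp
  \<comment> \<open>Since \<open>obs_fun A\<close> takes only the values \<open>0\<close> and
    \<open>1\<close>, any level strictly between them would serve.\<close>
  have "P \<in> B \<longleftrightarrow> spectral_family A (1/2) \<notin> B" if B: "B \<in> quasipoints R" for B
  proof
    assume "P \<in> B"
    hence "\<not> obs_fun A B < 1" using obs[OF B] by simp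
    thus "spectral_family A (1/2) \<notin> B"
      using obs_fun_less_iff[OF A B, of 1] by (auto dest: spec[of _ "1/2"])
  next
    assume "spectral_family A (1/2) \<notin> B"
    hence "0 < obs_fun A B" using obs_fun_greater_iff[OF A B, of 0] by (auto intro: exI[of _ "1/2"])
    thus "P \<in> B" using obs[OF B] by (auto split: if_splits)
  qed
  from complemented_imp_commute[OF P spectral_family_vN(2)[OF A] this Q]
  show "P (Q x) = Q (P x)" by blast
qed

subsection \<open>Abelian algebras\<close>

text \<open>The two semicontinuities of \<open>f\<close> act separately: \<open>open_gt\<close>
  keeps the supremum \<open>E l\<close> inside \<open>S l\<close>, and \<open>open_lt\<close> puts
  \<open>E l\<close> into \<open>B\<close> as soon as \<open>f B < l\<close>.\<close>

lemma surjective_if_abelian: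
  assumes ab: "abelian R" and f: "f \<in> bounded_continuous_functions R"
  shows "f \<in> observable_functions R"
proof -
  have ext: "f \<in> extensional (quasipoints R)"
    and open_gt: "\<And>a. openin (qp_topology R) {B \<in> quasipoints R. a < f B}"
    and open_lt: "\<And>a. openin (qp_topology R) {B \<in> quasipoints R. f B < a}"
    and bdd: "bounded (f ` quasipoints R)"
    using f unfolding bounded_continuous_functions_iff by blast+
  define S where "S l = {P \<in> projections R. \<forall>B\<in>qp_basic R P. f B \<le> l}" for l
  \<comment> \<open>The supremum of \<open>S l\<close> is built as the complement of the projection
    onto the common kernel, since intersections of ranges are what is available.\<close>
  define K where "K l = (\<Inter>P\<in>S l. {x. x - P x = x})" for l
  define G where "G l = orth_proj (K l)" for l
  define E where "E l = (\<lambda>x. x - G l x)" for l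
  have S_L: "P \<in> projections R" if "P \<in> S l" for P l using that by (simp add: S_def)
  have K: "closed_csubspace (K l)" for l
    unfolding K_def using is_projection_compl[OF proj_of[OF S_L]]
    by (intro closed_csubspace_INT closed_csubspace_range) blast
  have G: "G l \<in> projections R" for l
    unfolding G_def K_def using compl_in[OF S_L] by (intro orth_proj_range_INT[OF vN]) blast
  have G_fix: "G l x = x \<longleftrightarrow> (\<forall>P\<in>S l. P x = 0)" for l x
    unfolding G_def orth_proj_fixes_iff[OF K] by (simp add: K_def diff_eq_eq)
  have E: "E l \<in> projections R" for l unfolding E_def by (rule compl_in[OF G])
  note Ep = proj_of[OF E] and Gp = proj_of[OF G]
  have E_ge: "proj_le P (E l)" if P: "P \<in> S l" for P l
    unfolding proj_le_fixes[OF proj_of[OF S_L[OF P]] Ep]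
  proof (intro allI impI)
    fix x assume x: "P x = x"
    have "G l (G l x) = G l x" by (rule is_projectionD(2)[OF Gp])
    hence "P (G l x) = 0" using G_fix P by blast
    hence "cinner (G l x) (G l x) = 0"
      using is_projectionD(3)[OF proj_of[OF S_L[OF P]], of x "G l x"] x
        is_projectionD(2,3)[OF Gp] by simp
    thus "E l x = x" by (simp add: E_def cinner_eq_zero_iff)
  qed
  have E_S: "E l \<in> S l" for l
    unfolding S_def
  proof (intro CollectI conjI ballI E)
    fix B assume "B \<in> qp_basic R (E l)"
    hence B: "B \<in> quasipoints R" "E l \<in> B" by (auto simp: qp_basic_def)
    show "f B \<le> l"
    proof (rule ccontr)
      assume "\<not> f B \<le> l"
      then obtain X where X: "X \<in> B" "qp_basic R X \<subseteq> {B \<in> quasipoints R. l < f B}"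
        using openin_imp_basic[OF open_gt[of l]] B(1) by force
      have XL: "X \<in> projections R" using X(1) quasipointD(2)[OF B(1)] by auto
      have "P y = 0" if P: "P \<in> S l" and y: "X y = y" for P y
      proof -
        note PL = S_L[OF P]
        have disj: "proj_meet R P X = (\<lambda>x. 0)"
        proof (rule ccontr)
          assume "proj_meet R P X \<noteq> (\<lambda>x. 0)"
          then obtain B' where B': "B' \<in> quasipoints R" "proj_meet R P X \<in> B'"
            using quasipoint_exists[OF meet_in[OF PL XL]] by blast
          have "P \<in> B'" "X \<in> B'" using quasipoint_upward[OF B'] meet_le[OF PL XL] PL XL by blast+
          hence "f B' \<le> l" "l < f B'" using P X(2) B'(1) by (auto simp: S_def qp_basic_def)
          thus False by simp
        qed
        \<comment> \<open>Commutativity is used here: \<open>P y\<close> stays in the range of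
          \<open>X\<close>, so disjointness from \<open>X\<close> becomes orthogonality and passes
          to the supremum.\<close>
        have "X (P y) = P (X y)"
          using ab PL XL by (auto simp: abelian_def projections_def fun_eq_iff)
        hence "X (P y) = P y" by (simp add: y)
        thus ?thesis
          using disj is_projectionD(2)[OF proj_of[OF PL]] unfolding meet_zero_iff[OF PL XL] by blast
      qed
      hence "G l y = y" if "X y = y" for y using G_fix that by blast
      hence "proj_meet R (E l) X = (\<lambda>x. 0)"
        unfolding meet_zero_iff[OF E XL] by (auto simp: E_def)
      thus False using quasipoint_not_disjoint[OF B X(1)] by blast
    qed
  qed
  have le_f: "f B \<le> l" if "B \<in> quasipoints R" "E l \<in> B" for B l
    using E_S[of l] that by (auto simp: S_def qp_basic_def)
  interpret E: projection_family E
  proof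
    show "is_projection (E l)" for l by (rule Ep)
    show "proj_le (E l) (E m)" if "l \<le> m" for l m
    proof (rule E_ge)
      show "E l \<in> S m" using E_S[of l] that by (force simp: S_def)
    qed
  qed
  obtain M where M: "\<And>B. B \<in> quasipoints R \<Longrightarrow> \<bar>f B\<bar> \<le> M"
    using bdd unfolding bounded_iff by auto
  \<comment> \<open>The margin \<open>1\<close> puts \<open>a\<close> strictly below all values of
    \<open>f\<close> and ensures \<open>a < b\<close>.\<close>
  define a b where "a = - \<bar>M\<bar> - 1" and "b = \<bar>M\<bar> + 1"
  have E_zero: "E l = (\<lambda>x. 0)" if "l \<le> a" for l
  proof (rule ccontr)
    assume "E l \<noteq> (\<lambda>x. 0)"
    then obtain B where B: "B \<in> quasipoints R" "E l \<in> B" using quasipoint_exists[OF E] by blast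
    show False using le_f[OF B] M[OF B(1)] that by (simp add: a_def)
  qed
  have E_id: "E l = id" if "l \<ge> b" for l
  proof -
    have "f B \<le> l" if "B \<in> quasipoints R" for B using M[OF that] \<open>l \<ge> b\<close> by (simp add: b_def)
    hence "id \<in> S l" using projections_id[OF vN] by (auto simp: S_def qp_basic_def)
    hence "proj_le id (E l)" by (rule E_ge)
    thus ?thesis by (simp add: proj_le_def)
  qed
  have rc: "((\<lambda>m. E m x) \<longlongrightarrow> E l x) (at_right l)" for l x
  proof (rule E.strongly_right_continuous)
    fix x assume x: "\<And>m. l < m \<Longrightarrow> E m x = x"
    \<comment> \<open>\<open>F\<close> is the infimum of the later \<open>E m\<close>. As
      \<open>f \<le> m\<close> on its basic set for every \<open>m > l\<close>, it belongs to
      \<open>S l\<close> and lies below \<open>E l\<close>.\<close>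
    define F where "F = orth_proj (\<Inter>m\<in>{l<..}. {x. E m x = x})"
    have Mc: "closed_csubspace (\<Inter>m\<in>{l<..}. {x. E m x = x})"
      by (intro closed_csubspace_INT closed_csubspace_range Ep)
    have F: "F \<in> projections R" unfolding F_def by (intro orth_proj_range_INT[OF vN] E)
    have F_fix: "F x = x \<longleftrightarrow> (\<forall>m>l. E m x = x)" for x
      unfolding F_def orth_proj_fixes_iff[OF Mc] by auto
    have "f B \<le> l" if B: "B \<in> quasipoints R" "F \<in> B" for B
    proof (rule dense_ge)
      fix m assume "l < m"
      hence "proj_le F (E m)" unfolding proj_le_fixes[OF proj_of[OF F] Ep] F_fix by blast
      thus "f B \<le> m" using le_f[OF B(1)] quasipoint_upward[OF B E] by blast
    qed
    hence "F \<in> S l" using F by (auto simp: S_def qp_basic_def)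
    hence "proj_le F (E l)" by (rule E_ge)
    thus "E l x = x" using x unfolding proj_le_fixes[OF proj_of[OF F] Ep] F_fix by blast
  qed
  have "a < b" by (simp add: a_def b_def)
  then obtain A where A: "A \<in> bops" "adj A = A" "spectral_family_of A E"
    and comm: "\<And>T x. T \<in> bops \<Longrightarrow> (\<And>l x. T (E l x) = E l (T x)) \<Longrightarrow> T (A x) = A (T x)"
    using E.spectral_integral_exists[OF rc _ E_zero E_id] by metis
  have "T (A x) = A (T x)" if "T \<in> commutant R" for T x
    using comm[OF commutant_bops[OF that]] E that by (simp add: projections_iff[OF vN])
  hence "A \<in> R" using A(1) vN_iff[OF vN] by blast
  hence A_sa: "A \<in> self_adjoints R" using A(2) by (simp add: self_adjoints_def)
  have sf: "spectral_family A = E" by (rule spectral_family_unique[OF A(1,3)])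
  have "obs_fun A B = f B" if B: "B \<in> quasipoints R" for B
  proof (rule antisym)
    show "obs_fun A B \<le> f B"
    proof (rule dense_ge)
      fix l assume "f B < l"
      then obtain P where P: "P \<in> B" "qp_basic R P \<subseteq> {B \<in> quasipoints R. f B < l}"
        using openin_imp_basic[OF open_lt[of l]] B by force
      have "P \<in> S l" using P quasipointD(2)[OF B] by (force simp: S_def)
      hence "E l \<in> B" using quasipoint_upward[OF B P(1) E E_ge] by blast
      thus "obs_fun A B \<le> l"
        using obs_fun_greater_iff[OF A_sa B, of l] spectral_family_quasipoint_mono[OF A_sa B, of l] sf
        by (meson leI less_imp_le)
    qed
    show "f B \<le> obs_fun A B"
    proof (rule dense_ge)
      fix r assume "obs_fun A B < r"
      then obtain l where "l < r" "E l \<in> B" using obs_fun_less_iff[OF A_sa B] sf by auto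
      thus "f B \<le> r" using le_f[OF B] by force
    qed
  qed
  hence "f = restrict (obs_fun A) (quasipoints R)"
    using ext by (auto intro!: extensionalityI)
  thus ?thesis using A_sa unfolding observable_functions_def by blast
qed

end

theorem theorem2p5:
  fixes R :: "('h::chilbert_space \<Rightarrow> 'h) set"
  assumes "von_neumann_algebra R"
    and "\<exists>x::'h. x \<noteq> 0"
  shows "observable_functions R = bounded_continuous_functions R \<longleftrightarrow> abelian R"
proof -
  interpret nontrivial_vN R using assms by unfold_locales
  have "observable_functions R \<subseteq> bounded_continuous_functions R"
    using obs_fun_bounded_continuous by (auto simp: observable_functions_def)
  thus ?thesis using abelian_if_surjective surjective_if_abelian by blast
qed

end
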